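(* Let $a\colon \mathbb{N}_0 \to \mathbb{C}$ be an automatic sequence (i.e.\ $k$-automatic for some integer $k\ge 2$), and suppose that \[ \lim_{N \to \infty} \frac{1}{N} \sum_{n=0}^{N-1} a(n) b(n) = 0 \] for every periodic sequence $b\colon \mathbb{N}_0 \to \mathbb{C}$. Then $a$ is highly Gowers uniform.
   Context: For $k\ge2$, $\Sigma_k=\{0,1,\dots,k-1\}$ is the set of base-$k$ digits and $\Sigma_k^*$ the set of finite words over it; $(n)_k\in\Sigma_k^*$ denotes the base-$k$ expansion of $n\in\mathbb{N}_0$ without leading zeros ($(0)_k$ is the empty word). A $k$-automaton with output is $(S,s_0,\Sigma_k,\delta,\Omega,\tau)$ with $S$ a finite set of states, $s_0\in S$, $\delta\colon S\times\Sigma_k\to S$ (extended to words by $\delta(s,\mathbf{uv})=\delta(\delta(s,\mathbf u),\mathbf v)$) and $\tau\colon S\to\Omega$; it produces the sequence $a(n)=\tau(\delta(s_0,(n)_k))$ (input read from the most significant digit). A sequence is $k$-automatic if produced by some $k$-automaton. Gowers norms: for a finite abelian group $Z$, $d\ge1$ and $f\colon Z\to\mathbb C$, $\|f\|_{U^d(Z)}^{2^d}=\mathbb{E}_{(n_0,\dots,n_d)\in Z^{d+1}}\prod_{\omega\in\{0,1\}^d}\mathcal{C}^{|\omega|}f(n_0+\sum_{i=1}^d\omega_in_i)$, where $\mathcal C$ is complex conjugation and $|\omega|$ is the number of coordinates equal to $1$. For $N\ge1$, $[N]=\{0,1,\dots,N-1\}$, and for $f\colon[N]\to\mathbb C$ (or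 a sequence restricted to $[N]$), $\|f\|_{U^d[N]}=\|1_{[N]}f\|_{U^d(\mathbb Z/\tilde N\mathbb Z)}/\|1_{[N]}\|_{U^d(\mathbb Z/\tilde N\mathbb Z)}$, where $\tilde N$ is the least prime larger than $2dN$ and $[N]$ is viewed inside $\mathbb Z/\tilde N\mathbb Z$. A bounded sequence $a\colon\mathbb N_0\to\mathbb C$ is highly Gowers uniform if for each $d\ge1$ there exists $c=c_d>0$ with $\|a\|_{U^d[N]}\ll N^{-c}$ (as $N\to\infty$, implied constant independent of $N$). *)

theory Defs
  imports
    "HOL-Analysis.Analysis"
    "HOL-Computational_Algebra.Primes"
    "HOL-Library.Landau_Symbols"
    "HOL-Algebra.FiniteProduct"
    "HOL-Algebra.Elementary_Groups"
begin

text \<open>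
  The most significant digit comes first, and 0 is expanded to the empty word.
  For \<open>k < 2\<close> the value is a dummy.
\<close>

fun base_expansion :: "nat \<Rightarrow> nat \<Rightarrow> nat list" where
  "base_expansion k n =
     (if k < 2 \<or> n = 0 then [] else base_expansion k (n div k) @ [n mod k])"

declare base_expansion.simps [simp del]

text \<open>The output set of an automaton is the type \<open>'o\<close>.\<close>

record ('s, 'o) automaton =
  states :: "'s set"
  initial :: "'s"
  trans_fun :: "'s \<Rightarrow> nat \<Rightarrow> 's"
  output_fun :: "'s \<Rightarrow> 'o"

definition is_automaton :: "nat \<Rightarrow> ('s, 'o) automaton \<Rightarrow> bool" where
  "is_automaton k A \<longleftrightarrow>
     finite (states A) \<and> initial A \<in> states A \<and>
     (\<forall>s\<in>states A. \<forall>j\<in>{0..<k}. trans_fun A s j \<in> states A)"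

definition produced_sequence :: "nat \<Rightarrow> ('s, 'o) automaton \<Rightarrow> nat \<Rightarrow> 'o" where
  "produced_sequence k A n =
     output_fun A (foldl (trans_fun A) (initial A) (base_expansion k n))"

text \<open>
  HOL cannot quantify existentially over the type of states. Since the set of states is finite,
  it can be taken to consist of natural numbers without loss of generality.
\<close>

definition automatic_in_base :: "nat \<Rightarrow> (nat \<Rightarrow> 'o) \<Rightarrow> bool" where
  "automatic_in_base k a \<longleftrightarrow>
     (\<exists>A :: (nat, 'o) automaton. is_automaton k A \<and> (\<forall>n. a n = produced_sequence k A n))"

definition automatic :: "(nat \<Rightarrow> 'o) \<Rightarrow> bool" where
  "automatic a \<longleftrightarrow> (\<exists>k\<ge>2. automatic_in_base k a)"

definition periodic_seq :: "(nat \<Rightarrow> 'o) \<Rightarrow> bool" where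
  "periodic_seq b \<longleftrightarrow> (\<exists>p\<ge>1. \<forall>n. b (n + p) = b n)"


text \<open>
  The finite abelian group is written multiplicatively, so
  \<open>n\<^sub>0 + \<Sum>\<^sub>i \<omega>\<^sub>i n\<^sub>i\<close> becomes a product of powers.
\<close>

definition gowers_average :: "('g, 'm) monoid_scheme \<Rightarrow> nat \<Rightarrow> ('g \<Rightarrow> complex) \<Rightarrow> complex" where
  "gowers_average Z d f =
     (\<Sum>n \<in> {0..d} \<rightarrow>\<^sub>E carrier Z.
        \<Prod>\<omega> \<in> {1..d} \<rightarrow>\<^sub>E {0, 1::nat}.
          (cnj ^^ card {i\<in>{1..d}. \<omega> i = 1})
            (f (n 0 \<otimes>\<^bsub>Z\<^esub> (\<Otimes>\<^bsub>Z\<^esub>i\<in>{1..d}. n i [^]\<^bsub>Z\<^esub> \<omega> i))))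
     / of_nat (card (carrier Z) ^ (d + 1))"

text \<open>
  For \<open>d \<ge> 1\<close> the average is a nonnegative real number, and taking its real part
  only changes the type.
\<close>

definition gowers_norm :: "('g, 'm) monoid_scheme \<Rightarrow> nat \<Rightarrow> ('g \<Rightarrow> complex) \<Rightarrow> real" where
  "gowers_norm Z d f = root (2 ^ d) (Re (gowers_average Z d f))"

definition gowers_modulus :: "nat \<Rightarrow> nat \<Rightarrow> nat" where
  "gowers_modulus d N = (LEAST p. prime p \<and> 2 * d * N < p)"

text \<open>
  The elements of the cyclic group are the integers from 0 to the modulus minus 1, so
  \<open>{0..<N}\<close> embeds by \<open>int\<close>.
\<close>

definition extend_by_zero :: "nat \<Rightarrow> (nat \<Rightarrow> complex) \<Rightarrow> int \<Rightarrow> complex" where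
  "extend_by_zero N f x = (if x \<in> int ` {0..<N} then f (nat x) else 0)"

definition gowers_norm_interval :: "nat \<Rightarrow> nat \<Rightarrow> (nat \<Rightarrow> complex) \<Rightarrow> real" where
  "gowers_norm_interval d N f =
     gowers_norm (integer_mod_group (gowers_modulus d N)) d (extend_by_zero N f) /
     gowers_norm (integer_mod_group (gowers_modulus d N)) d (extend_by_zero N (\<lambda>_. 1))"

definition highly_gowers_uniform :: "(nat \<Rightarrow> complex) \<Rightarrow> bool" where
  "highly_gowers_uniform a \<longleftrightarrow>
     bounded (range a) \<and>
     (\<forall>d\<ge>1. \<exists>c>0. (\<lambda>N. gowers_norm_interval d N a) \<in> O(\<lambda>N. real N powr (- c)))"

end

theory Submission
  imports Defs "HOL-Combinatorics.Cycles"
begin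

text \<open>
  The sequences \<open>n \<mapsto> a (k^j n + v)\<close> form a finite set, on which digit blocks act. After passing to a
  power of the base, some digit \<open>z\<close> acts as an idempotent of least rank, with image \<open>Y\<close>, and each
  block \<open>v\<close> induces a permutation \<open>perm v\<close> of \<open>Y\<close>, multiplicative under \<open>u, v \<mapsto> u z v\<close>.
  The tuples of permutations at the vertices of \<open>d\<close>-dimensional cubes of blocks form a group; let \<open>H\<close>
  be the subgroup of those \<open>h\<close> that occur at one vertex with the identity at all the others. Modulo
  \<open>H\<close> the last vertex of a cube is determined by the others, so by the cubes \<open>n + card W\<close> the coset of
  \<open>perm (n + d)\<close> is determined by those of \<open>perm n, \<dots>, perm (n + d - 1)\<close>, and \<open>v \<mapsto> perm v H\<close> is
  eventually periodic with bounds that do not depend on the length of the blocks. As \<open>a\<close> is orthogonal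
  to periodic sequences, the sum of \<open>h y\<close> over \<open>h \<in> H\<close> vanishes on \<open>Y\<close> up to a fixed block.

  Splitting off low digits turns a Gowers average at scale \<open>K N\<close> into \<open>K^(d+1)\<close> averages of the same
  kind at scale \<open>N\<close>. The ones that belong to the elements of \<open>H\<close> differ at one vertex only and cancel.
  Each scale thus gains a factor smaller than 1, which gives a power saving.
\<close>

section \<open>Sections of a sequence and the change of base\<close>

text \<open>For \<open>m = k ^ j\<close> and \<open>r < m\<close> this reads \<open>f\<close> at the
  numbers whose last \<open>j\<close> base-\<open>k\<close> digits spell \<open>r\<close>.
  Composition is concatenation of words, with the outer word in the more significant place.\<close>

definition sample :: "nat \<Rightarrow> nat \<Rightarrow> (nat \<Rightarrow> complex) \<Rightarrow> nat \<Rightarrow> complex" where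
  "sample m r f = (\<lambda>n. f (m * n + r))"

lemma sample_sample: "sample m r (sample m' r' f) = sample (m * m') (m' * r + r') f"
  by (simp add: sample_def algebra_simps)

lemma sample_1_0 [simp]: "sample (Suc 0) 0 f = f"
  by (simp add: sample_def)

definition orth_periodic :: "(nat \<Rightarrow> complex) \<Rightarrow> bool" where
  "orth_periodic f \<longleftrightarrow>
     (\<forall>b. periodic_seq b \<longrightarrow> (\<lambda>N. (\<Sum>n<N. f n * b n) / of_nat N) \<longlonglongrightarrow> 0)"

lemma sum_residue_class:
  fixes f :: "nat \<Rightarrow> complex"
  assumes "r < m"
  shows "(\<Sum>x<m * N. if x mod m = r then f x else 0) = (\<Sum>n<N. f (m * n + r))"
proof (induction N)
  case (Suc N)
  have "(\<Sum>x<m * Suc N. if x mod m = r then f x else 0) =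
    (\<Sum>x<m * N. if x mod m = r then f x else 0) +
    (\<Sum>x\<in>{m * N..<m * N + m}. if x mod m = r then f x else 0)"
    by (subst sum.union_disjoint [symmetric]) (auto intro: sum.cong)
  also have "(\<Sum>x\<in>{m * N..<m * N + m}. if x mod m = r then f x else 0) =
    (\<Sum>i<m. if i = r then f (m * N + i) else 0)"
    unfolding sum.atLeastLessThan_shift_0 [of _ "m * N"]
    by (intro sum.cong) auto
  also have "\<dots> = f (m * N + r)"
    using assms by simp
  finally show ?case using Suc by simp
qed simp

text \<open>A periodic \<open>b\<close> is carried to a sequence \<open>b'\<close> supported on the
  residue class of \<open>r\<close>, with period \<open>m * p\<close>. Up to the factor
  \<open>m\<close>, averages of \<open>f * b'\<close> over length \<open>m * N\<close> are averages
  of the sample against \<open>b\<close>.\<close>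

lemma orth_periodic_sample:
  assumes f: "orth_periodic f" and r: "r < m"
  shows "orth_periodic (sample m r f)"
  unfolding orth_periodic_def
proof (intro allI impI)
  fix b :: "nat \<Rightarrow> complex"
  assume "periodic_seq b"
  then obtain p where p: "p \<ge> 1" "\<And>n. b (n + p) = b n"
    by (auto simp: periodic_seq_def)
  have m: "m > 0" using r by simp
  define b' where "b' x = (if x mod m = r then b (x div m) else 0)" for x
  have "b' (x + m * p) = b' x" for x
    using m p(2) [of "x div m"] by (simp add: b'_def add.commute [of p])
  then have "periodic_seq b'"
    unfolding periodic_seq_def using p(1) m by (intro exI [of _ "m * p"]) simp
  then have lim: "(\<lambda>N. (\<Sum>n<N. f n * b' n) / of_nat N) \<longlonglongrightarrow> 0"
    using f by (simp add: orth_periodic_def)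
  have "filterlim (\<lambda>N. m * N) at_top sequentially"
    using m by (simp add: filterlim_subseq strict_mono_def)
  from filterlim_compose [OF lim this]
  have "(\<lambda>N. of_nat m * ((\<Sum>n<m * N. f n * b' n) / of_nat (m * N))) \<longlonglongrightarrow> of_nat m * 0"
    by (intro tendsto_mult tendsto_const)
  moreover have "of_nat m * ((\<Sum>n<m * N. f n * b' n) / of_nat (m * N)) =
     (\<Sum>n<N. sample m r f n * b n) / of_nat N" for N
  proof -
    have "(\<Sum>n<m * N. f n * b' n) = (\<Sum>x<m * N. if x mod m = r then f x * b (x div m) else 0)"
      by (intro sum.cong) (auto simp: b'_def)
    also have "\<dots> = (\<Sum>n<N. sample m r f n * b n)"
      using r m by (subst sum_residue_class) (auto simp: sample_def intro!: sum.cong)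
    finally show ?thesis using m by simp
  qed
  ultimately show "(\<lambda>N. (\<Sum>n<N. sample m r f n * b n) / of_nat N) \<longlonglongrightarrow> 0"
    by simp
qed

section \<open>Automata and finiteness of the kernel\<close>

text \<open>The case \<open>n = 0\<close> is excluded because leading zeros are dropped, so the
  expansion of \<open>v\<close> alone may be shorter than \<open>w\<close>.\<close>

lemma base_expansion_append:
  assumes k: "2 \<le> k"
  shows "v < k ^ j \<Longrightarrow> \<exists>w. set w \<subseteq> {0..<k} \<and>
    (\<forall>n>0. base_expansion k (k ^ j * n + v) = base_expansion k n @ w)"
proof (induction j arbitrary: v)
  case (Suc j)
  have "v div k < k ^ j"
    using Suc.prems k by (simp add: less_mult_imp_div_less mult.commute)
  then obtain w where w: "set w \<subseteq> {0..<k}"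
      "\<And>n. n > 0 \<Longrightarrow> base_expansion k (k ^ j * n + v div k) = base_expansion k n @ w"
    using Suc.IH by blast
  have "base_expansion k (k ^ Suc j * n + v) = base_expansion k n @ (w @ [v mod k])" if "n > 0" for n
  proof -
    have "(k ^ Suc j * n + v) div k = k ^ j * n + v div k"
      using k by (simp add: mult.assoc)
    moreover have "(k ^ Suc j * n + v) mod k = v mod k"
      by (simp add: mult.assoc)
    ultimately show ?thesis
      using k that w(2) [OF that] by (subst base_expansion.simps) simp
  qed
  moreover have "set (w @ [v mod k]) \<subseteq> {0..<k}" using w(1) k by auto
  ultimately show ?case by blast
qed (auto intro: exI [of _ "[]"])

lemma set_base_expansion: "2 \<le> k \<Longrightarrow> set (base_expansion k n) \<subseteq> {0..<k}"
  by (induction k n rule: base_expansion.induct) (subst base_expansion.simps, auto)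

lemma foldl_trans_fun_in_states:
  "is_automaton k A \<Longrightarrow> s \<in> states A \<Longrightarrow> set w \<subseteq> {0..<k} \<Longrightarrow>
    foldl (trans_fun A) s w \<in> states A"
  by (induction w arbitrary: s) (auto simp: is_automaton_def)

text \<open>This is the \<open>k\<close>-kernel of \<open>a\<close>.\<close>

definition kernel_of :: "nat \<Rightarrow> (nat \<Rightarrow> complex) \<Rightarrow> (nat \<Rightarrow> complex) set" where
  "kernel_of k a = {sample (k ^ j) v a |j v. v < k ^ j}"

text \<open>A kernel element is given by finite data: its word \<open>w\<close> acts on the states,
  which yields a map \<open>h\<close> from states to outputs, and the value at \<open>0\<close>,
  where the expansion behaves differently, is recorded separately.\<close>

lemma automatic_finite:
  assumes "automatic_in_base k a" and k: "2 \<le> k"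
  shows "finite (range a)" and "finite (kernel_of k a)"
proof -
  from assms obtain A :: "(nat, complex) automaton"
    where A: "is_automaton k A" and a: "\<And>n. a n = produced_sequence k A n"
    by (auto simp: automatic_in_base_def)
  define S where "S = states A"
  define \<sigma> where "\<sigma> n = foldl (trans_fun A) (initial A) (base_expansion k n)" for n
  have finS: "finite S" using A by (simp add: S_def is_automaton_def)
  have \<sigma>: "\<sigma> n \<in> S" for n
    unfolding \<sigma>_def S_def using A set_base_expansion [OF k]
    by (intro foldl_trans_fun_in_states) (auto simp: is_automaton_def)
  have a\<sigma>: "a n = output_fun A (\<sigma> n)" for n
    by (simp add: a produced_sequence_def \<sigma>_def)
  show fin: "finite (range a)"
    by (rule finite_subset [of _ "output_fun A ` S"]) (use \<sigma> finS in \<open>auto simp: a\<sigma>\<close>)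
  define T where "T = (S \<rightarrow>\<^sub>E output_fun A ` S) \<times> range a"
  have "kernel_of k a \<subseteq> (\<lambda>(h, c) n. if n = 0 then c else h (\<sigma> n)) ` T"
  proof
    fix f assume "f \<in> kernel_of k a"
    then obtain j v where f: "f = sample (k ^ j) v a" and v: "v < k ^ j"
      by (auto simp: kernel_of_def)
    obtain w where w: "set w \<subseteq> {0..<k}"
      "\<And>n. n > 0 \<Longrightarrow> base_expansion k (k ^ j * n + v) = base_expansion k n @ w"
      using base_expansion_append [OF k v] by blast
    define h where "h = restrict (\<lambda>s. output_fun A (foldl (trans_fun A) s w)) S"
    have "f = (\<lambda>n. if n = 0 then a v else h (\<sigma> n))"
    proof
      fix n
      show "f n = (if n = 0 then a v else h (\<sigma> n))"
        using w(2) [of n] \<sigma> [of n]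
        by (cases "n = 0") (auto simp: f sample_def a\<sigma> h_def, simp add: \<sigma>_def)
    qed
    moreover have "(h, a v) \<in> T"
      using foldl_trans_fun_in_states [OF A _ w(1)] by (auto simp: T_def h_def S_def)
    ultimately show "f \<in> (\<lambda>(h, c) n. if n = 0 then c else h (\<sigma> n)) ` T"
      by (intro image_eqI [of _ _ "(h, a v)"]) auto
  qed
  moreover have "finite T"
    unfolding T_def using finS fin by (intro finite_cartesian_product finite_PiE) auto
  ultimately show "finite (kernel_of k a)"
    using finite_subset by blast
qed

lemma kernel_of_sample:
  assumes "f \<in> kernel_of k a" "v < k ^ i"
  shows "sample (k ^ i) v f \<in> kernel_of k a"
proof -
  obtain j u where f: "f = sample (k ^ j) u a" "u < k ^ j"
    using assms by (auto simp: kernel_of_def)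
  have "k ^ j * v + u < k ^ j * v + k ^ j" using f by simp
  also have "\<dots> = k ^ j * Suc v" by simp
  also have "\<dots> \<le> k ^ j * k ^ i" using assms by (intro mult_left_mono) auto
  finally have "k ^ j * v + u < k ^ (i + j)" by (simp add: power_add mult.commute)
  moreover have "sample (k ^ i) v f = sample (k ^ (i + j)) (k ^ j * v + u) a"
    by (simp add: f(1) sample_sample power_add)
  ultimately show ?thesis
    unfolding kernel_of_def by (intro CollectI exI conjI)
qed

section \<open>A base in which some digit is idempotent of least rank\<close>

lemma finite_permutes_power:
  assumes S: "finite S" and p: "bij_betw p S S"
  shows "\<exists>n>0. \<forall>x\<in>S. (p ^^ n) x = x"
proof -
  define q where "q x = (if x \<in> S then p x else x)" for x
  have "bij_betw q S S" using p by (subst bij_betw_cong [of S q p]) (auto simp: q_def)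
  then have q: "q permutes S" by (intro bij_imp_permutes) (auto simp: q_def)
  then have "permutation q" using S permutation_permutes by blast
  then obtain n where n: "q ^^ n = id" "n > 0" by (rule permutation_is_nilpotent)
  have "(p ^^ m) x = (q ^^ m) x \<and> (q ^^ m) x \<in> S" if "x \<in> S" for x m
    by (induction m) (use that p in \<open>auto simp: q_def bij_betw_def\<close>)
  then have "\<forall>x\<in>S. (p ^^ n) x = x" using n by auto
  then show ?thesis using n(2) by blast
qed

text \<open>The situation after the change of base. \<open>fixed\<close> makes the digit
  \<open>z\<close> idempotent. The number \<open>z * k ^ j + v\<close> spells \<open>z\<close>
  followed by the \<open>j\<close> digits of \<open>v\<close>, so \<open>bij\<close> says that every
  word starting with \<open>z\<close> permutes the image of \<open>z\<close>.\<close>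

locale kernel_action =
  fixes k z :: nat and \<K> :: "(nat \<Rightarrow> complex) set" and C :: real
  assumes k: "2 \<le> k" and z: "z < k" and fin: "finite \<K>"
    and closed: "\<And>f v. f \<in> \<K> \<Longrightarrow> v < k \<Longrightarrow> sample k v f \<in> \<K>"
    and fixed: "\<And>f. f \<in> \<K> \<Longrightarrow> sample k z (sample k z f) = sample k z f"
    and bij: "\<And>j v. v < k ^ j \<Longrightarrow>
      bij_betw (sample (k ^ Suc j) (z * k ^ j + v)) (sample k z ` \<K>) (sample k z ` \<K>)"
    and orth: "\<And>f. f \<in> \<K> \<Longrightarrow> orth_periodic f"
    and bound: "\<And>f n. f \<in> \<K> \<Longrightarrow> norm (f n) \<le> C"

lemma sample_funpow:
  "\<exists>r<m^n. sample m r0 ^^ n = sample (m ^ n) r" if "r0 < m"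
proof (induction n)
  case 0
  show ?case by (auto simp: sample_def)
next
  case (Suc n)
  then obtain r where r: "r < m ^ n" "sample m r0 ^^ n = sample (m ^ n) r" by blast
  have "m ^ n * r0 + r < m ^ n * Suc r0" using r by simp
  also have "\<dots> \<le> m ^ n * m" using that by (intro mult_left_mono) auto
  finally have "m ^ n * r0 + r < m ^ Suc n" by (simp add: mult.commute)
  moreover have "sample m r0 ^^ Suc n = sample (m ^ Suc n) (m ^ n * r0 + r)"
    by (rule ext) (simp add: r(2) sample_sample)
  ultimately show ?case by blast
qed

text \<open>The digit \<open>z\<close> is a power of a word whose action on the kernel has an image of the
  smallest possible size; words that begin with it can only permute this image.\<close>

lemma kernel_exists:
  assumes a: "automatic a" and orth: "orth_periodic a"
  obtains k z \<K> C where "kernel_action k z \<K> C" "a \<in> \<K>"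
proof -
  obtain k0 where k0: "2 \<le> k0" "automatic_in_base k0 a"
    using a by (auto simp: automatic_def)
  define \<K> where "\<K> = kernel_of k0 a"
  have fin: "finite \<K>" and finr: "finite (range a)"
    using automatic_finite [OF k0(2,1)] by (auto simp: \<K>_def)
  have aK: "a \<in> \<K>"
    unfolding \<K>_def kernel_of_def by (force intro: exI [of _ 0])
  have cl: "sample (k0 ^ i) v f \<in> \<K>" if "f \<in> \<K>" "v < k0 ^ i" for f v i
    using that by (simp add: \<K>_def kernel_of_sample)
  define rk where "rk = (\<lambda>(i, v). card (sample (k0 ^ i) v ` \<K>))"
  \<comment> \<open>The empty word is excluded, so that the new base is a positive power of the old
    one.\<close>
  define P where "P = (\<lambda>(i, v). 1 \<le> i \<and> v < k0 ^ i)"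
  have "P (1, 0)" using k0 by (simp add: P_def)
  then obtain w where w: "P w" "\<And>w'. P w' \<Longrightarrow> rk w \<le> rk w'"
    using ex_has_least_nat [of P "(1, 0)" rk] by blast
  obtain l v where wlv: "w = (l, v)" by fastforce
  have l: "1 \<le> l" and v: "v < k0 ^ l" using w(1) by (auto simp: wlv P_def)
  have least: "card (sample (k0 ^ l) v ` \<K>) \<le> card (sample (k0 ^ i) u ` \<K>)"
    if "1 \<le> i" "u < k0 ^ i" for i u
    using w(2) [of "(i, u)"] that by (simp add: P_def rk_def wlv)
  define Y where "Y = sample (k0 ^ l) v ` \<K>"
  have YK: "Y \<subseteq> \<K>" using cl v by (auto simp: Y_def)
  have finY: "finite Y" using fin by (simp add: Y_def)
  \<comment> \<open>Minimality is applied to the word \<open>u\<close> followed by \<open>v\<close>,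
    whose image is the image of \<open>Y\<close> under \<open>u\<close>. Being contained in
    \<open>Y\<close> and not smaller, it is all of \<open>Y\<close>.\<close>
  have perm: "bij_betw (sample (k0 ^ i) u) Y Y"
    if iu: "u < k0 ^ i" and im: "sample (k0 ^ i) u ` Y \<subseteq> Y" for i u
  proof -
    have "k0 ^ l * u + v < k0 ^ l * Suc u" using v by simp
    also have "\<dots> \<le> k0 ^ l * k0 ^ i" using iu by (intro mult_left_mono) auto
    finally have lt: "k0 ^ l * u + v < k0 ^ (i + l)" by (simp add: power_add mult.commute)
    have "sample (k0 ^ i) u ` Y = sample (k0 ^ (i + l)) (k0 ^ l * u + v) ` \<K>"
      by (simp add: Y_def image_image sample_sample power_add)
    then have "card Y \<le> card (sample (k0 ^ i) u ` Y)"
      using least [of "i + l", OF _ lt] l by (simp add: Y_def)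
    then have "sample (k0 ^ i) u ` Y = Y"
      using im finY by (metis card_seteq)
    then show ?thesis
      using finY by (simp add: bij_betw_def eq_card_imp_inj_on)
  qed
  have "bij_betw (sample (k0 ^ l) v) Y Y"
    using perm [OF v] YK by (auto simp: Y_def)
  from finite_permutes_power [OF finY this] obtain q
    where q: "q > 0" "\<And>y. y \<in> Y \<Longrightarrow> (sample (k0 ^ l) v ^^ q) y = y" by blast
  define k where "k = (k0 ^ l) ^ q"
  obtain z where z: "z < k" "sample (k0 ^ l) v ^^ q = sample k z"
    using sample_funpow [OF v, of q] by (auto simp: k_def)
  have kk0: "k = k0 ^ (l * q)" by (simp add: k_def power_mult)
  have lq: "0 < l * q" using l q(1) by simp
  have k2: "2 \<le> k"
    using k0 self_le_power [of k0 "l * q"] lq unfolding kk0 by linarith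
  have Yim: "sample k z ` \<K> = Y"
  proof
    have *: "(sample (k0 ^ l) v ^^ n) f \<in> \<K>" if "f \<in> \<K>" for f n
      by (induction n) (use that cl v in auto)
    obtain q' where q': "q = Suc q'" using q(1) by (cases q) auto
    show "sample k z ` \<K> \<subseteq> Y"
    proof
      fix y assume "y \<in> sample k z ` \<K>"
      then obtain f where "f \<in> \<K>" "y = (sample (k0 ^ l) v ^^ q) f" by (auto simp: z(2))
      then show "y \<in> Y" using * [of f q'] by (auto simp: q' Y_def)
    qed
    show "Y \<subseteq> sample k z ` \<K>"
      using q(2) YK unfolding z(2) by (metis image_eqI subsetD subsetI)
  qed
  have "kernel_action k z \<K> (Max (norm ` range a))"
  proof
    show "2 \<le> k" "z < k" "finite \<K>" by fact+
    show "sample k u f \<in> \<K>" if "f \<in> \<K>" "u < k" for f u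
      using cl that by (simp add: kk0)
    show "sample k z (sample k z f) = sample k z f" if "f \<in> \<K>" for f
      using q(2) [of "sample k z f"] that Yim by (auto simp: z(2))
    show "orth_periodic f" if "f \<in> \<K>" for f
      using that orth_periodic_sample [OF orth] by (auto simp: \<K>_def kernel_of_def)
    show "norm (f n) \<le> Max (norm ` range a)" if "f \<in> \<K>" for f n
      using that finr by (intro Max_ge) (auto simp: \<K>_def kernel_of_def sample_def)
    show "bij_betw (sample (k ^ Suc j) (z * k ^ j + u)) (sample k z ` \<K>) (sample k z ` \<K>)"
      if u: "u < k ^ j" for j u
    proof -
      have "z * k ^ j + u < Suc z * k ^ j" using u by simp
      also have "\<dots> \<le> k * k ^ j" using z(1) by (intro mult_right_mono) auto
      finally have lt: "z * k ^ j + u < k ^ Suc j" by simp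
      have pw: "k0 ^ (l * q * Suc j) = k ^ Suc j" by (simp only: kk0 power_mult)
      \<comment> \<open>The leading digit \<open>z\<close> acts last and therefore puts every value
        into \<open>Y\<close>.\<close>
      have "sample (k ^ Suc j) (z * k ^ j + u) y \<in> Y" if "y \<in> Y" for y
      proof -
        have "sample (k ^ j) u y \<in> \<K>"
          using cl [of y u "l * q * j"] u that YK by (auto simp: kk0 power_mult)
        moreover have "sample (k ^ Suc j) (z * k ^ j + u) y = sample k z (sample (k ^ j) u y)"
          by (simp add: sample_sample mult.commute)
        ultimately show ?thesis using Yim by auto
      qed
      then have "sample (k ^ Suc j) (z * k ^ j + u) ` Y \<subseteq> Y" by blast
      then show ?thesis
        using perm [of "z * k ^ j + u" "l * q * Suc j"] lt unfolding pw Yim by blast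
    qed
  qed
  then show thesis using aK that by blast
qed

section \<open>Recurrences and residue classes\<close>

text \<open>There are finitely many permutations of \<open>S\<close>, so exponents of the single
  ones can be multiplied together.\<close>

lemma finite_permutes_exponent:
  assumes S: "finite S"
  shows "\<exists>n>0. \<forall>p. p permutes S \<longrightarrow> p ^^ n = id"
proof -
  have *: "finite A \<Longrightarrow> \<forall>p\<in>A. p permutes S \<Longrightarrow> \<exists>n>0. \<forall>p\<in>A. p ^^ n = id" for A
  proof (induction A rule: finite_induct)
    case (insert p A)
    obtain m where m: "m > 0" "p ^^ m = id"
      using insert.prems S permutation_is_nilpotent [of p] permutation_permutes by blast
    obtain n where n: "n > 0" "\<forall>q\<in>A. q ^^ n = id" using insert by blast
    have "q ^^ (m * n) = id" if "q \<in> insert p A" for q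
    proof (cases "q = p")
      case True
      then show ?thesis using m by (simp add: funpow_mult [symmetric])
    next
      case False
      then have "q ^^ (n * m) = id" using n that by (simp add: funpow_mult [symmetric])
      then show ?thesis by (simp add: mult.commute)
    qed
    then show ?case using m n by (intro exI [of _ "m * n"]) auto
  qed auto
  show ?thesis using * [OF finite_permutations [OF S]] by auto
qed

text \<open>Among the first \<open>B + 1\<close> windows of length \<open>d\<close> two agree, and
  the recurrence propagates the period \<open>p = n2 - n1\<close>. Since \<open>p \<le> B\<close>,
  it divides \<open>fact B\<close>; threshold and period thus depend on \<open>card Q\<close> and
  \<open>d\<close> only, not on \<open>s\<close> or \<open>M\<close>.\<close>

lemma window_recurrence_periodic:
  fixes s :: "nat \<Rightarrow> 'a"
  assumes d: "1 \<le> d" and Q: "finite Q" "\<And>n. n < M \<Longrightarrow> s n \<in> Q"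
    and step: "\<And>n n'. n + d < M \<Longrightarrow> n' + d < M \<Longrightarrow>
      (\<And>i. i < d \<Longrightarrow> s (n + i) = s (n' + i)) \<Longrightarrow> s (n + d) = s (n' + d)"
    and B: "B = card {xs. set xs \<subseteq> Q \<and> length xs = d}" and M: "B + d \<le> M"
    and n: "B \<le> n" "n + fact B < M"
  shows "s (n + fact B) = s n"
proof -
  define w where "w n = map s [n..<n + d]" for n
  have "w ` {0..B} \<subseteq> {xs. set xs \<subseteq> Q \<and> length xs = d}"
    using Q(2) M by (auto simp: w_def)
  then have "card (w ` {0..B}) \<le> B"
    unfolding B using finite_lists_length_eq [OF Q(1)] by (intro card_mono) auto
  then have "\<not> inj_on w {0..B}"
    using card_image [of w "{0..B}"] by auto
  then obtain n1 n2 where nn: "n1 < n2" "n2 \<le> B" "w n1 = w n2"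
    by (metis atLeastAtMost_iff linorder_inj_onI' )
  define p where "p = n2 - n1"
  have win: "s (n1 + i) = s (n2 + i)" if "i < d" for i
    using arg_cong [OF nn(3), of "\<lambda>xs. xs ! i"] that by (simp add: w_def)
  have per: "n1 \<le> m \<Longrightarrow> m + p < M \<Longrightarrow> s (m + p) = s m" for m
  proof (induction m rule: less_induct)
    case (less m)
    show ?case
    proof (cases "m < n1 + d")
      case True
      then show ?thesis using win [of "m - n1"] less.prems nn(1) by (simp add: p_def add.commute)
    next
      case False
      define m' where "m' = m - d"
      have m: "m = m' + d" "n1 \<le> m'" using False by (auto simp: m'_def)
      have "s (m' + p + d) = s (m' + d)"
      proof (rule step)
        show "m' + p + d < M" "m' + d < M" using less.prems m by auto
        show "s (m' + p + i) = s (m' + i)" if "i < d" for i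
          using less.IH [of "m' + i"] less.prems m that by (simp add: add_ac)
      qed
      then show ?thesis by (simp add: m add_ac)
    qed
  qed
  have mult: "n + q * p < M \<Longrightarrow> s (n + q * p) = s n" for q
  proof (induction q)
    case (Suc q)
    then show ?case using per [of "n + q * p"] n(1) nn by (simp add: add_ac)
  qed simp
  have "p dvd fact B" using nn by (intro dvd_fact) (auto simp: p_def)
  then obtain q where q: "fact B = q * p" by (metis dvd_div_mult_self)
  show ?thesis using mult [of q] n(2) unfolding q by blast
qed

lemma card_residue_class_ge:
  assumes P: "0 < (P::nat)" and \<rho>: "\<rho> < P"
  shows "L div P \<le> card {m \<in> {a..<a + L}. m mod P = \<rho>}"
proof -
  \<comment> \<open>\<open>u\<close> is the first number from \<open>a\<close> on in the class of
    \<open>\<rho>\<close>; its translates by multiples of \<open>P\<close> give the count.\<close>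
  define u where "u = a + (\<rho> + (P - a mod P)) mod P"
  have "a mod P + (\<rho> + (P - a mod P)) = \<rho> + P"
    using P mod_less_divisor [of P a] by linarith
  then have "u mod P = \<rho>"
    unfolding u_def mod_add_right_eq using \<rho>
    by (subst mod_add_left_eq [symmetric]) simp
  moreover have "u < a + P" "a \<le> u" using P by (auto simp: u_def)
  moreover have "u + i * P < a + L" if "i < L div P" for i
  proof -
    have "u + i * P < a + Suc i * P" using \<open>u < a + P\<close> by simp
    also have "Suc i * P \<le> (L div P) * P" using that by (intro mult_right_mono) auto
    also have "\<dots> \<le> L" by simp
    finally show ?thesis by simp
  qed
  ultimately have "(\<lambda>i. u + i * P) ` {..<L div P} \<subseteq> {m \<in> {a..<a + L}. m mod P = \<rho>}"
    by (auto simp: trans_le_add1)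
  then have "card ((\<lambda>i. u + i * P) ` {..<L div P}) \<le> card {m \<in> {a..<a + L}. m mod P = \<rho>}"
    by (intro card_mono) auto
  then show ?thesis using P by (simp add: card_image inj_on_def)
qed

text \<open>Indicators of residue classes are periodic, and the finitely many classes modulo
  \<open>P\<close> share one \<open>N0\<close>.\<close>

lemma orth_periodic_residue_class:
  assumes F: "orth_periodic F" and P: "0 < P" and \<epsilon>: "0 < \<epsilon>"
  shows "\<exists>N0. \<forall>N\<ge>N0. \<forall>\<rho><P. norm (\<Sum>m<N. if m mod P = \<rho> then F m else 0) \<le> \<epsilon> * real N"
proof -
  have "\<forall>\<^sub>F N in sequentially. norm (\<Sum>m<N. if m mod P = \<rho> then F m else 0) \<le> \<epsilon> * real N" for \<rho>
  proof -
    define b :: "nat \<Rightarrow> complex" where "b m = (if m mod P = \<rho> then 1 else 0)" for m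
    have "periodic_seq b"
      unfolding periodic_seq_def using P by (intro exI [of _ P]) (auto simp: b_def)
    then have "(\<lambda>N. (\<Sum>n<N. F n * b n) / of_nat N) \<longlonglongrightarrow> 0"
      using F by (simp add: orth_periodic_def)
    then have "\<forall>\<^sub>F N in sequentially. norm ((\<Sum>n<N. F n * b n) / of_nat N) < \<epsilon>"
      using \<epsilon> by (auto simp: tendsto_iff dist_norm)
    then show ?thesis
    proof (eventually_elim)
      case (elim N)
      have "(\<Sum>n<N. F n * b n) = (\<Sum>m<N. if m mod P = \<rho> then F m else 0)"
        by (intro sum.cong) (auto simp: b_def)
      then show ?case
        using elim by (cases "N = 0") (auto simp: norm_divide divide_simps less_imp_le)
    qed
  qed
  then have "\<forall>\<^sub>F N in sequentially. \<forall>\<rho>\<in>{..<P}.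
      norm (\<Sum>m<N. if m mod P = \<rho> then F m else 0) \<le> \<epsilon> * real N"
    by (intro eventually_ball_finite) auto
  then show ?thesis by (auto simp: eventually_sequentially)
qed

text \<open>The value \<open>\<kappa>\<close> recurs along a whole residue class in the part of
  \<open>[q * k ^ j, (q + 1) * k ^ j)\<close> past the preperiod. For fixed \<open>q\<close> this
  class has a density bounded below among the numbers up to its end, which orthogonality forbids
  unless \<open>\<kappa> = 0\<close>.\<close>

lemma periodic_blocks_vanish:
  assumes F: "orth_periodic F" and P: "0 < P" and k: "2 \<le> (k::nat)"
    and per: "\<And>j v. j0 \<le> j \<Longrightarrow> B \<le> v \<Longrightarrow> v + P < k ^ j \<Longrightarrow> F (q * k ^ j + (v + P)) = F (q * k ^ j + v)"
    and val: "\<And>j. j0 \<le> j \<Longrightarrow> \<exists>v. B \<le> v \<and> v < k ^ j \<and> F (q * k ^ j + v) = \<kappa>"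
  shows "\<kappa> = 0"
proof (rule ccontr)
  assume \<kappa>: "\<kappa> \<noteq> 0"
  \<comment> \<open>With this choice two partial sums up to \<open>(q + 1) * M\<close> amount to at
    most \<open>norm \<kappa> * M / (4 * P)\<close>, whereas the class contributes about
    \<open>norm \<kappa> * M / P\<close>.\<close>
  define \<epsilon> where "\<epsilon> = norm \<kappa> / (8 * real P * real (q + 1))"
  have \<epsilon>: "\<epsilon> > 0" using \<kappa> P by (simp add: \<epsilon>_def)
  define S where "S \<rho> N = (\<Sum>m<N. if m mod P = \<rho> then F m else 0)" for \<rho> N
  obtain N0 where N0: "\<And>N \<rho>. N0 \<le> N \<Longrightarrow> \<rho> < P \<Longrightarrow> norm (S \<rho> N) \<le> \<epsilon> * real N"
    using orth_periodic_residue_class [OF F P \<epsilon>] by (auto simp: S_def)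
  \<comment> \<open>Adding \<open>N0\<close> puts both end points of the interval beyond
    \<open>N0\<close>, and the choice of \<open>j\<close> makes \<open>M\<close> exceed
    \<open>2 * (B' + P)\<close>.\<close>
  define B' where "B' = B + N0"
  define j where "j = j0 + 2 * (B' + P)"
  define M where "M = k ^ j"
  have "j < 2 ^ j" by simp
  also have "\<dots> \<le> k ^ j" using k by (intro power_mono) auto
  finally have M: "2 * (B' + P) < M" by (simp add: M_def j_def)
  obtain v where v: "B \<le> v" "v < M" "F (q * M + v) = \<kappa>"
    using val [of j] by (auto simp: j_def M_def)
  define \<rho> where "\<rho> = (q * M + v) mod P"
  have \<rho>: "\<rho> < P" using P by (simp add: \<rho>_def)
  have per': "u + i * P < M \<Longrightarrow> B \<le> u \<Longrightarrow> F (q * M + (u + i * P)) = F (q * M + u)" for u i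
  proof (induction i)
    case (Suc i)
    then show ?case using per [of j "u + i * P"] by (simp add: M_def j_def add_ac)
  qed simp
  have le: "F (q * M + w) = F (q * M + u)"
    if "B \<le> u" "u \<le> w" "w < M" "(q * M + u) mod P = (q * M + w) mod P" for u w
  proof -
    have "P dvd (q * M + w) - (q * M + u)"
      using that mod_eq_dvd_iff_nat [of "q * M + u" "q * M + w" P] by simp
    then have "P dvd w - u" by simp
    then obtain i where "w - u = i * P" by (metis dvdE mult.commute)
    then have "w = u + i * P" using that by simp
    then show ?thesis using per' that by simp
  qed
  have const: "F m = \<kappa>" if "m \<in> {q * M + B'..<q * M + M}" "m mod P = \<rho>" for m
  proof -
    define u where "u = m - q * M"
    have u: "m = q * M + u" "B \<le> u" "u < M"
      using that(1) M by (auto simp: B'_def u_def)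
    show ?thesis
      using le [of u v] le [of v u] u v that(2) by (cases "u \<le> v") (auto simp: \<rho>_def)
  qed
  define V where "V = {m \<in> {q * M + B'..<q * M + M}. m mod P = \<rho>}"
  have "S \<rho> (q * M + M) - S \<rho> (q * M + B') = (\<Sum>m = q * M + B'..<q * M + M. if m mod P = \<rho> then F m else 0)"
    unfolding S_def lessThan_atLeast0 using M
    by (subst sum_diff_nat_ivl) auto
  also have "\<dots> = (\<Sum>m\<in>V. F m)"
    unfolding V_def by (rule sum.inter_filter [symmetric]) simp
  also have "\<dots> = of_nat (card V) * \<kappa>"
    using const by (simp add: V_def)
  finally have "real (card V) * norm \<kappa> = norm (S \<rho> (q * M + M) - S \<rho> (q * M + B'))"
    by (simp add: norm_mult)
  also have "\<dots> \<le> norm (S \<rho> (q * M + M)) + norm (S \<rho> (q * M + B'))"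
    by (rule norm_triangle_ineq4)
  also have "\<dots> \<le> \<epsilon> * real (q * M + M) + \<epsilon> * real (q * M + B')"
    using M by (intro add_mono N0 \<rho>) (auto simp: B'_def)
  also have "\<dots> \<le> \<epsilon> * (2 * real (q + 1) * real M)"
  proof -
    have "real (q * M + M) + real (q * M + B') \<le> 2 * real (q + 1) * real M"
      using M by (simp add: algebra_simps)
    from mult_left_mono [OF this, of \<epsilon>] show ?thesis
      using \<epsilon> by (simp only: distrib_left less_imp_le)
  qed
  also have "\<dots> = norm \<kappa> * (real M / (4 * real P))"
    unfolding \<epsilon>_def by (simp add: field_simps del: of_nat_add of_nat_Suc add: of_nat_eq_0_iff)
  finally have "real (card V) * norm \<kappa> \<le> real M / (4 * real P) * norm \<kappa>" by (simp only: mult.commute)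
  moreover have "0 < norm \<kappa>" using \<kappa> by simp
  ultimately have up: "real (card V) \<le> real M / (4 * real P)"
    by (simp only: mult_le_cancel_right_pos)
  have "V = {m \<in> {q * M + B'..<(q * M + B') + (M - B')}. m mod P = \<rho>}"
    using M by (simp add: V_def)
  then have "(M - B') div P \<le> card V"
    using card_residue_class_ge [OF P \<rho>] by simp
  moreover have "real (M - B') / real P \<le> real ((M - B') div P) + 1"
  proof -
    have "M - B' < P * ((M - B') div P + 1)"
      using P by (simp add: dividend_less_times_div)
    then have "real (M - B') < real (P * ((M - B') div P + 1))"
      by (simp only: of_nat_less_iff)
    then show ?thesis
      using P by (simp add: divide_le_eq distrib_left mult.commute del: of_nat_diff)
  qed
  ultimately have "real (M - B') / real P \<le> real M / (4 * real P) + 1" using up by linarith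
  then have "real (M - B') \<le> real M / 4 + real P"
    using P by (simp add: field_simps)
  moreover have "real (M - B') = real M - real B'" using M by simp
  moreover have "real (2 * (B' + P)) < real M" using M by (simp only: of_nat_less_iff)
  ultimately show False by simp
qed

section \<open>Cubes of digit blocks\<close>

abbreviation pinv :: "('a \<Rightarrow> 'a) \<Rightarrow> 'a \<Rightarrow> 'a" where "pinv \<equiv> inv_into UNIV"

definition vertex :: "(nat \<Rightarrow> int) \<Rightarrow> nat set \<Rightarrow> int" where
  "vertex c W = c 0 + (\<Sum>i\<in>W. c i)"

lemma vertex_empty [simp]: "vertex c {} = c 0"
  by (simp add: vertex_def)

text \<open>Taking the vertex \<open>V\<close> as the origin of the cube reverses the edges in
  \<open>V\<close> and relabels vertices by symmetric difference with \<open>V\<close>.\<close>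

lemma vertex_reflect:
  assumes "finite W" "finite V" "0 \<notin> W"
  shows "vertex (\<lambda>i. if i = 0 then vertex c V else if i \<in> V then - c i else c i) W =
    vertex c ((W - V) \<union> (V - W))"
proof -
  have "(\<Sum>i\<in>W. if i = 0 then vertex c V else if i \<in> V then - c i else c i) =
      (\<Sum>i\<in>W. if i \<in> V then - c i else c i)"
    using assms by (intro sum.cong) auto
  also have "\<dots> = (\<Sum>i\<in>W \<inter> V. - c i) + (\<Sum>i\<in>W - V. c i)"
    using assms by (simp add: sum.If_cases Diff_eq Int_def)
  also have "(\<Sum>i\<in>W \<inter> V. - c i) = - (\<Sum>i\<in>V \<inter> W. c i)"
    by (simp add: sum_negf Int_commute)
  moreover have "sum c V = sum c (V \<inter> W) + sum c (V - W)"
    using assms by (metis Diff_disjoint Int_Diff_Un Int_Diff_disjoint finite_Diff finite_Int sum.union_disjoint)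
  moreover have "sum c ((W - V) \<union> (V - W)) = sum c (W - V) + sum c (V - W)"
    using assms by (intro sum.union_disjoint) auto
  ultimately show ?thesis by (simp add: vertex_def)
qed

locale kernel_cube = kernel_action +
  fixes d :: nat
  assumes d: "1 \<le> d"
begin

definition Y :: "(nat \<Rightarrow> complex) set" where "Y = sample k z ` \<K>"

definition block :: "nat \<Rightarrow> nat \<Rightarrow> (nat \<Rightarrow> complex) \<Rightarrow> nat \<Rightarrow> complex" where
  "block j v = sample (k ^ Suc j) (z * k ^ j + v)"

text \<open>The extension by the identity outside \<open>Y\<close> gives elements of the symmetric
  group of \<open>Y\<close> in the sense of \<open>permutes\<close>, so relations on
  \<open>Y\<close> become equations between functions.\<close>

definition perm :: "nat \<Rightarrow> nat \<Rightarrow> (nat \<Rightarrow> complex) \<Rightarrow> nat \<Rightarrow> complex" where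
  "perm j v = (\<lambda>y. if y \<in> Y then block j v y else y)"

text \<open>The leading \<open>z\<close> of the inner block comes to stand between the two words,
  which is why the product belongs to \<open>u z v\<close>.\<close>

lemma block_block:
  "block j u (block i v f) = block (Suc (j + i)) (u * k ^ Suc i + z * k ^ i + v) f"
  by (simp add: block_def sample_sample algebra_simps power_add)

lemma finite_Y: "finite Y"
  using fin by (simp add: Y_def)

lemma Y_subset: "Y \<subseteq> \<K>"
  using closed z by (auto simp: Y_def)

lemma sample_z: "y \<in> Y \<Longrightarrow> sample k z y = y"
  using fixed by (auto simp: Y_def)

lemma bij_block: "v < k ^ j \<Longrightarrow> bij_betw (block j v) Y Y"
  unfolding block_def Y_def by (rule bij)

lemma block_in_Y: "v < k ^ j \<Longrightarrow> y \<in> Y \<Longrightarrow> block j v y \<in> Y"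
  using bij_block bij_betwE by blast

text \<open>The last digit acts first, and \<open>z\<close> fixes \<open>y\<close>. Blocks can
  therefore be padded to any greater length.\<close>

lemma block_append_z: "y \<in> Y \<Longrightarrow> block (Suc j) (v * k + z) y = block j v y"
  by (subst (2) sample_z [symmetric]) (simp_all add: block_def sample_sample algebra_simps)

lemma block_0: "y \<in> Y \<Longrightarrow> block 0 0 y = y"
  by (simp add: block_def sample_z)

lemma perm_permutes: "v < k ^ j \<Longrightarrow> perm j v permutes Y"
  using bij_block [of v j] bij_betw_cong [of Y "perm j v" "block j v" Y]
  by (intro bij_imp_permutes) (auto simp: perm_def)

lemma perm_comp:
  "v < k ^ i \<Longrightarrow> perm j u \<circ> perm i v = perm (Suc (j + i)) (u * k ^ Suc i + z * k ^ i + v)"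
  by (rule ext) (simp add: perm_def block_block block_in_Y)

lemma perm_append_z: "perm (Suc j) (v * k + z) = perm j v"
  by (rule ext) (simp add: perm_def block_append_z)

lemma perm_0: "perm 0 0 = id"
  by (rule ext) (simp add: perm_def block_0)

lemma append_digit_less: "u < k ^ j \<Longrightarrow> v < k \<Longrightarrow> u * k + v < k ^ Suc j"
proof -
  assume uv: "u < k ^ j" "v < k"
  then have "u * k + v < Suc u * k" by simp
  also have "\<dots> \<le> k ^ j * k" using uv by (intro mult_right_mono) auto
  finally show "u * k + v < k ^ Suc j" by (simp add: mult.commute)
qed

lemma concat_less:
  assumes "u < k ^ j" "v < k ^ i"
  shows "u * k ^ Suc i + z * k ^ i + v < k ^ Suc (j + i)"
proof -
  have "u * k ^ Suc i + z * k ^ i + v < (u * k + z + 1) * k ^ i"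
    using assms by (simp add: algebra_simps)
  also have "\<dots> \<le> k ^ Suc j * k ^ i"
    using append_digit_less [OF assms(1) z] by (intro mult_right_mono) auto
  finally show ?thesis by (simp add: power_add)
qed

section \<open>The group of cubes of permutations\<close>

text \<open>The edge vectors of these cubes may be negative; only the vertices are digit blocks.\<close>

definition cube_at :: "nat \<Rightarrow> (nat \<Rightarrow> int) \<Rightarrow> (nat set \<Rightarrow> (nat \<Rightarrow> complex) \<Rightarrow> (nat \<Rightarrow> complex)) \<Rightarrow> bool" where
  "cube_at j c t \<longleftrightarrow> (\<forall>W\<subseteq>{1..d}. 0 \<le> vertex c W \<and> vertex c W < int k ^ j \<and>
     t W = perm j (nat (vertex c W)))"

text \<open>The length \<open>j\<close> is left free, since multiplying cubes lengthens their
  blocks.\<close>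

definition is_cube :: "(nat set \<Rightarrow> (nat \<Rightarrow> complex) \<Rightarrow> (nat \<Rightarrow> complex)) \<Rightarrow> bool" where
  "is_cube t \<longleftrightarrow> (\<exists>j c. cube_at j c t)"

lemma nat_less_power: "0 \<le> x \<Longrightarrow> x < int k ^ j \<Longrightarrow> nat x < k ^ j"
  by (metis nat_less_iff of_nat_power)

lemma int_less_power: "v < k ^ j \<Longrightarrow> int v < int k ^ j"
  by (metis of_nat_less_iff of_nat_power)

lemma is_cube_permutes: "is_cube t \<Longrightarrow> W \<subseteq> {1..d} \<Longrightarrow> t W permutes Y"
  unfolding is_cube_def cube_at_def by (auto intro!: perm_permutes nat_less_power)

lemma is_cube_cong:
  "(\<And>W. W \<subseteq> {1..d} \<Longrightarrow> t W = t' W) \<Longrightarrow> is_cube t \<longleftrightarrow> is_cube t'"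
  unfolding is_cube_def cube_at_def by simp

text \<open>Concatenation is affine in the two words, hence in the edge vectors. The constant
  \<open>e\<close> of the separating digit enters through coordinate \<open>0\<close> alone, so that
  every vertex receives it exactly once.\<close>

lemma vertex_affine:
  assumes "0 \<notin> W"
  shows "vertex (\<lambda>i. a * c i + (b * c' i + (if i = 0 then e else 0))) W =
    a * vertex c W + (b * vertex c' W + e)"
proof -
  have "(\<Sum>i\<in>W. a * c i + (b * c' i + (if i = 0 then e else 0))) = (\<Sum>i\<in>W. a * c i + b * c' i)"
    using assms by (intro sum.cong) auto
  then show ?thesis
    by (simp add: vertex_def sum.distrib sum_distrib_left algebra_simps)
qed

lemma is_cube_id: "is_cube (\<lambda>_. id)"
  unfolding is_cube_def cube_at_def
  by (intro exI [of _ 0] exI [of _ "\<lambda>_. 0"]) (simp add: vertex_def perm_0)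

lemma is_cube_comp:
  assumes "is_cube t" "is_cube t'"
  shows "is_cube (\<lambda>W. t W \<circ> t' W)"
proof -
  obtain j c i c' where c: "cube_at j c t" and c': "cube_at i c' t'"
    using assms by (auto simp: is_cube_def)
  \<comment> \<open>These coordinates put the word \<open>u z v\<close> at a vertex with words
    \<open>u\<close> and \<open>v\<close>.\<close>
  let ?c = "\<lambda>l. int k ^ Suc i * c l + (1 * c' l + (if l = 0 then int z * int k ^ i else 0))"
  have "cube_at (Suc (j + i)) ?c (\<lambda>W. t W \<circ> t' W)"
    unfolding cube_at_def
  proof (intro allI impI)
    fix W assume W: "W \<subseteq> {1..d}"
    define u v where "u = nat (vertex c W)" and "v = nat (vertex c' W)"
    have u: "vertex c W = int u" "u < k ^ j" "t W = perm j u"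
      using c W nat_less_power by (auto simp: cube_at_def u_def)
    have v: "vertex c' W = int v" "v < k ^ i" "t' W = perm i v"
      using c' W nat_less_power by (auto simp: cube_at_def v_def)
    have "0 \<notin> W" using W by auto
    then have "vertex ?c W = int k ^ Suc i * vertex c W + (1 * vertex c' W + int z * int k ^ i)"
      by (rule vertex_affine)
    then have *: "vertex ?c W = int (u * k ^ Suc i + z * k ^ i + v)"
      by (simp only: u(1) v(1)) (simp add: algebra_simps)
    show "0 \<le> vertex ?c W \<and> vertex ?c W < int k ^ Suc (j + i) \<and>
        t W \<circ> t' W = perm (Suc (j + i)) (nat (vertex ?c W))"
      unfolding * u(3) v(3) perm_comp [OF v(2)] nat_int
      using int_less_power [OF concat_less [OF u(2) v(2)]] by simp
  qed
  then show ?thesis unfolding is_cube_def by blast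
qed

lemma cube_at_Suc:
  assumes "cube_at j c t"
  shows "\<exists>c'. cube_at (Suc j) c' t"
proof -
  \<comment> \<open>The coefficient \<open>0\<close> removes the second cube and leaves the word
    \<open>u z\<close>.\<close>
  let ?c = "\<lambda>l. int k * c l + (0 * c l + (if l = 0 then int z else 0))"
  have "cube_at (Suc j) ?c t"
    unfolding cube_at_def
  proof (intro allI impI)
    fix W assume W: "W \<subseteq> {1..d}"
    define u where "u = nat (vertex c W)"
    have u: "vertex c W = int u" "u < k ^ j" "t W = perm j u"
      using assms W nat_less_power by (auto simp: cube_at_def u_def)
    have "0 \<notin> W" using W by auto
    then have "vertex ?c W = int k * vertex c W + (0 * vertex c W + int z)"
      by (rule vertex_affine)
    then have *: "vertex ?c W = int (u * k + z)"
      by (simp only: u(1)) (simp add: algebra_simps)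
    show "0 \<le> vertex ?c W \<and> vertex ?c W < int k ^ Suc j \<and> t W = perm (Suc j) (nat (vertex ?c W))"
      unfolding * u(3) nat_int perm_append_z
      using int_less_power [OF append_digit_less [OF u(2) z]] by simp
  qed
  then show ?thesis by blast
qed

lemma cube_at_mono:
  assumes "cube_at j c t" and "j \<le> j'"
  shows "\<exists>c'. cube_at j' c' t"
  using assms(2)
proof (induction rule: dec_induct)
  case base
  then show ?case using assms(1) by blast
next
  case (step n)
  then show ?case using cube_at_Suc by blast
qed

lemma is_cube_reflect:
  assumes "is_cube t" "V \<subseteq> {1..d}"
  shows "is_cube (\<lambda>W. t ((W - V) \<union> (V - W)))"
proof -
  obtain j c where c: "cube_at j c t" using assms by (auto simp: is_cube_def)
  have "cube_at j (\<lambda>i. if i = 0 then vertex c V else if i \<in> V then - c i else c i)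
     (\<lambda>W. t ((W - V) \<union> (V - W)))"
    unfolding cube_at_def
  proof (intro allI impI)
    fix W assume W: "W \<subseteq> {1..d}"
    have *: "finite W" "finite V" "0 \<notin> W" using W assms(2) finite_subset by auto
    have "(W - V) \<union> (V - W) \<subseteq> {1..d}" using W assms(2) by auto
    then show "0 \<le> vertex (\<lambda>i. if i = 0 then vertex c V else if i \<in> V then - c i else c i) W \<and>
       vertex (\<lambda>i. if i = 0 then vertex c V else if i \<in> V then - c i else c i) W < int k ^ j \<and>
       t ((W - V) \<union> (V - W)) =
       perm j (nat (vertex (\<lambda>i. if i = 0 then vertex c V else if i \<in> V then - c i else c i) W))"
      unfolding vertex_reflect [OF *] using c unfolding cube_at_def by blast
  qed
  then show ?thesis unfolding is_cube_def by blast
qed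

lemma is_cube_funpow: "is_cube t \<Longrightarrow> is_cube (\<lambda>W. t W ^^ n)"
  by (induction n) (use is_cube_id is_cube_comp in \<open>auto simp: id_def\<close>)

text \<open>The exponent is common to all permutations because the inverse of a cube has to be the
  same power at each of its vertices.\<close>

lemma permutes_inv_funpow:
  obtains n where "\<And>p. p permutes Y \<Longrightarrow> pinv p = p ^^ n"
proof -
  obtain n where n: "n > 0" "\<And>p. p permutes Y \<Longrightarrow> p ^^ n = id"
    using finite_permutes_exponent [OF finite_Y] by blast
  have "pinv p = p ^^ (n - 1)" if "p permutes Y" for p
  proof (rule inv_unique_comp)
    obtain m where "n = Suc m" using n(1) gr0_implies_Suc by blast
    then show "p \<circ> p ^^ (n - 1) = id" "p ^^ (n - 1) \<circ> p = id"
      using n(2) [OF that] funpow_Suc_right [of m p] by simp_all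
  qed
  then show thesis using that by blast
qed

lemma is_cube_inv:
  assumes "is_cube t"
  shows "is_cube (\<lambda>W. pinv (t W))"
proof -
  obtain n where "\<And>p. p permutes Y \<Longrightarrow> pinv p = p ^^ n" using permutes_inv_funpow by blast
  then show ?thesis
    using is_cube_funpow [OF assms, of n] is_cube_cong [of "\<lambda>W. pinv (t W)" "\<lambda>W. t W ^^ n"]
      is_cube_permutes [OF assms] by simp
qed

section \<open>The subgroup of single-vertex entries\<close>

definition H :: "((nat \<Rightarrow> complex) \<Rightarrow> (nat \<Rightarrow> complex)) set" where
  "H = {h. is_cube (\<lambda>W. if W = {1..d} then h else id)}"

lemma H_permutes: "h \<in> H \<Longrightarrow> h permutes Y"
  using is_cube_permutes [of _ "{1..d}"] by (force simp: H_def)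

lemma finite_H: "finite H"
  by (rule finite_subset [OF _ finite_permutations [OF finite_Y]]) (use H_permutes in auto)

lemma H_id: "id \<in> H"
  using is_cube_id by (simp add: H_def)

lemma H_comp: "h \<in> H \<Longrightarrow> h' \<in> H \<Longrightarrow> h \<circ> h' \<in> H"
  unfolding H_def mem_Collect_eq
  by (drule (1) is_cube_comp, erule is_cube_cong [THEN iffD1, rotated]) auto

lemma H_inv: "h \<in> H \<Longrightarrow> pinv h \<in> H"
  unfolding H_def mem_Collect_eq
  by (drule is_cube_inv, erule is_cube_cong [THEN iffD1, rotated]) auto

text \<open>By reflection, an element of \<open>H\<close> may be placed at any vertex of a cube.\<close>

lemma is_cube_single:
  assumes "h \<in> H" "V \<subseteq> {1..d}"
  shows "is_cube (\<lambda>W. if W = V then h else id)"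
proof -
  define D where "D = {1..d}"
  have "is_cube (\<lambda>W. if W = D then h else id)"
    using assms(1) by (simp add: H_def D_def)
  from is_cube_reflect [OF this, of "D - V"]
  have *: "is_cube (\<lambda>W. if (W - (D - V)) \<union> ((D - V) - W) = D then h else id)"
    by (simp add: D_def)
  have "(W - (D - V)) \<union> ((D - V) - W) = D \<longleftrightarrow> W = V" if "W \<subseteq> D" for W
  proof
    assume eq: "(W - (D - V)) \<union> ((D - V) - W) = D"
    have "V \<subseteq> D" using assms(2) by (simp add: D_def)
    show "W = V"
    proof (rule Set.set_eqI)
      fix x
      have "x \<in> (W - (D - V)) \<union> ((D - V) - W) \<longleftrightarrow> x \<in> D" by (simp only: eq)
      then show "x \<in> W \<longleftrightarrow> x \<in> V"
        using subsetD [OF \<open>W \<subseteq> D\<close>, of x] subsetD [OF \<open>V \<subseteq> D\<close>, of x]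
        by (cases "x \<in> W"; cases "x \<in> V") simp_all
    qed
  qed (use assms(2) in \<open>auto simp: D_def\<close>)
  then have "(if (W - (D - V)) \<union> ((D - V) - W) = D then h else id) = (if W = V then h else id)"
    if "W \<subseteq> {1..d}" for W
    using that by (simp add: D_def)
  from is_cube_cong [THEN iffD1, OF this *] show ?thesis .
qed

text \<open>Multiplying by single-vertex cubes with entry \<open>pinv (s V)\<close> clears the
  proper vertices one after another, until only the last vertex carries an entry.\<close>

lemma H_corner:
  assumes s: "is_cube s" and H: "\<And>W. W \<subset> {1..d} \<Longrightarrow> s W \<in> H"
  shows "s {1..d} \<in> H"
proof -
  have "is_cube (\<lambda>W. if W \<in> \<W> then id else s W)"
    if "finite \<W>" "\<W> \<subseteq> {W. W \<subset> {1..d}}" for \<W>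
    using that
  proof (induction \<W> rule: finite_induct)
    case (insert V \<W>)
    have V: "V \<subset> {1..d}" using insert by auto
    have "is_cube (\<lambda>W. (if W = V then pinv (s V) else id) \<circ> (if W \<in> \<W> then id else s W))"
      using insert V by (intro is_cube_comp is_cube_single H_inv H) auto
    moreover have "pinv (s V) \<circ> s V = id"
      using permutes_inv_o(2) [OF H_permutes [OF H [OF V]]] .
    ultimately show ?case
      using insert.hyps
      by (subst is_cube_cong [of _ "\<lambda>W. (if W = V then pinv (s V) else id) \<circ> (if W \<in> \<W> then id else s W)"]) auto
  qed (use s in simp)
  note * = this
  have "finite {W. W \<subset> {1..d}}"
    by (rule finite_subset [of _ "Pow {1..d}"]) auto
  from * [OF this subset_refl] have "is_cube (\<lambda>W. if W \<in> {W. W \<subset> {1..d}} then id else s W)" .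
  moreover have "(if W \<in> {W. W \<subset> {1..d}} then id else s W) = (if W = {1..d} then s {1..d} else id)"
    if "W \<subseteq> {1..d}" for W
    using that by (simp add: psubset_eq)
  ultimately have "is_cube (\<lambda>W. if W = {1..d} then s {1..d} else id)"
    by (rule is_cube_cong [THEN iffD1, rotated])
  then show ?thesis unfolding H_def mem_Collect_eq .
qed

section \<open>Cosets of \<open>H\<close> and their periodicity\<close>

definition coset :: "((nat \<Rightarrow> complex) \<Rightarrow> (nat \<Rightarrow> complex)) \<Rightarrow> ((nat \<Rightarrow> complex) \<Rightarrow> (nat \<Rightarrow> complex)) set" where
  "coset p = (\<lambda>h. p \<circ> h) ` H"

lemma coset_eq_iff:
  assumes p: "p permutes Y" and q: "q permutes Y"
  shows "coset p = coset q \<longleftrightarrow> pinv p \<circ> q \<in> H"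
proof
  assume "coset p = coset q"
  moreover have "q \<in> coset q"
    unfolding coset_def by (rule image_eqI [OF _ H_id]) simp
  ultimately obtain h where h: "h \<in> H" "q = p \<circ> h" by (auto simp: coset_def)
  then show "pinv p \<circ> q \<in> H"
    using permutes_inv_o(2) [OF p] by (simp add: o_assoc)
next
  define h where "h = pinv p \<circ> q"
  assume "pinv p \<circ> q \<in> H"
  then have h: "h \<in> H" by (simp add: h_def)
  have eq: "q = p \<circ> h" by (simp add: h_def o_assoc permutes_inv_o(1) [OF p])
  have "q \<circ> pinv h = p \<circ> (h \<circ> pinv h)" by (simp only: eq o_assoc)
  then have eq': "p = q \<circ> pinv h"
    by (simp only: permutes_inv_o(1) [OF H_permutes [OF h]] comp_id)
  show "coset p = coset q"
  proof
    have "q \<circ> h' \<in> coset p" if "h' \<in> H" for h'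
      unfolding coset_def using H_comp [OF h that]
      by (rule image_eqI [rotated]) (simp only: eq comp_assoc)
    then show "coset q \<subseteq> coset p" by (auto simp: coset_def)
    have "p \<circ> h' \<in> coset q" if "h' \<in> H" for h'
      unfolding coset_def using H_comp [OF H_inv [OF h] that]
      by (rule image_eqI [rotated]) (metis eq' comp_assoc)
    then show "coset p \<subseteq> coset q" by (auto simp: coset_def)
  qed
qed

text \<open>The cubes with all edge vectors equal to 1 have the vertices \<open>n + card W\<close>.\<close>

lemma coset_window:
  assumes n: "n + d < k ^ j" and n': "n' + d < k ^ j'"
    and eq: "\<And>i. i < d \<Longrightarrow> coset (perm j (n + i)) = coset (perm j' (n' + i))"
  shows "coset (perm j (n + d)) = coset (perm j' (n' + d))"
proof -
  have cube: "is_cube (\<lambda>W. perm j (n + card W))" if "n + d < k ^ j" for n j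
  proof -
    have "cube_at j (\<lambda>i. if i = 0 then int n else 1) (\<lambda>W. perm j (n + card W))"
      unfolding cube_at_def
    proof (intro allI impI)
      fix W assume W: "W \<subseteq> {1..d}"
      then have "card W \<le> d" using card_mono [of "{1..d}" W] by simp
      then have "int (n + card W) < int k ^ j" using that by (intro int_less_power) simp
      moreover have "(\<Sum>i\<in>W. if i = 0 then int n else 1) = (\<Sum>i\<in>W. 1)"
        using W by (intro sum.cong) auto
      then have *: "vertex (\<lambda>i. if i = 0 then int n else 1) W = int (n + card W)"
        by (simp add: vertex_def)
      ultimately show "0 \<le> vertex (\<lambda>i. if i = 0 then int n else 1) W \<and>
           vertex (\<lambda>i. if i = 0 then int n else 1) W < int k ^ j \<and>
           perm j (n + card W) = perm j (nat (vertex (\<lambda>i. if i = 0 then int n else 1) W))"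
        unfolding * nat_int by simp
    qed
    then show ?thesis unfolding is_cube_def by blast
  qed
  have less: "n + i < k ^ j" "n' + i < k ^ j'" if "i \<le> d" for i
    using n n' that by auto
  \<comment> \<open>The quotient of the two cubes has entries in \<open>H\<close> at the proper
    vertices, where \<open>card W < d\<close> and the cosets agree; \<open>H_corner\<close> then
    gives the last vertex.\<close>
  define s where "s = (\<lambda>W :: nat set. pinv (perm j (n + card W)) \<circ> perm j' (n' + card W))"
  have "is_cube s"
    unfolding s_def by (intro is_cube_comp is_cube_inv cube n n')
  moreover have "s W \<in> H" if "W \<subset> {1..d}" for W
  proof -
    have "card W < d" using psubset_card_mono [OF _ that] by simp
    then show ?thesis
      unfolding s_def using eq less by (subst coset_eq_iff [symmetric]) (auto intro!: perm_permutes)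
  qed
  ultimately have "s {1..d} \<in> H" by (rule H_corner)
  then show ?thesis
    using less [of d] by (subst coset_eq_iff) (auto simp: s_def intro!: perm_permutes)
qed

text \<open>There are finitely many cosets, and \<open>coset_window\<close> is a recurrence on
  windows of length \<open>d\<close>. The bounds come from the number of possible windows, so they
  serve all lengths \<open>j\<close>.\<close>

lemma coset_eventually_periodic:
  "\<exists>B P. 0 < P \<and> (\<forall>j v. B + d \<le> k ^ j \<longrightarrow> B \<le> v \<longrightarrow> v + P < k ^ j \<longrightarrow>
    coset (perm j (v + P)) = coset (perm j v))"
proof -
  define Q where "Q = coset ` {p. p permutes Y}"
  have Q: "finite Q" using finite_permutations [OF finite_Y] by (simp add: Q_def)
  define B where "B = card {xs. set xs \<subseteq> Q \<and> length xs = d}"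
  have "coset (perm j (v + fact B)) = coset (perm j v)"
    if "B + d \<le> k ^ j" "B \<le> v" "v + fact B < k ^ j" for j v
    using that
    by (intro window_recurrence_periodic [OF d Q _ _ B_def, where M = "k ^ j"] coset_window)
       (auto simp: Q_def perm_permutes)
  then show ?thesis by (intro exI [of _ B] exI [of _ "fact B"]) simp
qed

section \<open>Vanishing of the sums over \<open>H\<close>\<close>

definition average :: "(nat \<Rightarrow> complex) \<Rightarrow> nat \<Rightarrow> complex" where
  "average y n = (\<Sum>h\<in>H. h y n)"

lemma H_in_Y: "h \<in> H \<Longrightarrow> y \<in> Y \<Longrightarrow> h y \<in> Y"
  using H_permutes permutes_in_image by metis

text \<open>The right-hand side depends on \<open>v\<close> only through a coset, so these values
  inherit the periodicity of the cosets.\<close>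

lemma block_average:
  assumes y: "y \<in> Y" and v: "v < k ^ j"
  shows "block j v (average y) n = (\<Sum>p\<in>coset (perm j v). p y n)"
proof -
  have "inj_on (\<lambda>h. perm j v \<circ> h) H"
    using fun.inj_map [OF permutes_inj [OF perm_permutes [OF v]]] by (rule inj_on_subset) simp
  then have "(\<Sum>p\<in>coset (perm j v). p y n) = (\<Sum>h\<in>H. perm j v (h y) n)"
    by (simp add: coset_def sum.reindex)
  also have "\<dots> = (\<Sum>h\<in>H. block j v (h y) n)"
    using H_in_Y y by (simp add: perm_def)
  finally show ?thesis by (simp add: block_def sample_def average_def)
qed

lemma orth_periodic_average:
  assumes "y \<in> Y"
  shows "orth_periodic (average y)"
  unfolding orth_periodic_def
proof (intro allI impI)
  fix b :: "nat \<Rightarrow> complex" assume b: "periodic_seq b"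
  have "(\<lambda>N. (\<Sum>n<N. h y n * b n) / of_nat N) \<longlonglongrightarrow> 0" if "h \<in> H" for h
    using orth [of "h y"] H_in_Y [OF that assms] Y_subset b by (auto simp: orth_periodic_def)
  then have "(\<lambda>N. \<Sum>h\<in>H. (\<Sum>n<N. h y n * b n) / of_nat N) \<longlonglongrightarrow> (\<Sum>h\<in>H. 0)"
    by (intro tendsto_sum)
  moreover have "(\<Sum>h\<in>H. (\<Sum>n<N. h y n * b n) / of_nat N) = (\<Sum>n<N. average y n * b n) / of_nat N" for N
    unfolding average_def sum_distrib_right sum_divide_distrib [symmetric]
    by (subst sum.swap) simp
  ultimately show "(\<lambda>N. (\<Sum>n<N. average y n * b n) / of_nat N) \<longlonglongrightarrow> 0" by simp
qed

text \<open>The word \<open>1\<close> followed by \<open>j\<close> digits \<open>z\<close> acts like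
  \<open>1\<close>. Its leading digit makes its value at least \<open>k ^ j\<close> even when
  \<open>z = 0\<close>, so it gets past any preperiod.\<close>

lemma block_1_representative:
  "\<exists>v. k ^ j \<le> v \<and> v < k ^ Suc j \<and> (\<forall>y\<in>Y. block (Suc j) v y = block 1 1 y)"
proof (induction j)
  case 0
  show ?case using k by (intro exI [of _ 1]) auto
next
  case (Suc j)
  then obtain v where v: "k ^ j \<le> v" "v < k ^ Suc j" "\<forall>y\<in>Y. block (Suc j) v y = block 1 1 y" by blast
  have "k ^ Suc j \<le> v * k + z"
    using mult_right_mono [OF v(1), of k] by (simp add: mult.commute trans_le_add1)
  then show ?case
    using v append_digit_less [OF v(2) z] block_append_z by (intro exI [of _ "v * k + z"]) auto
qed

text \<open>For fixed \<open>n\<close>, the values of \<open>average y\<close> at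
  \<open>(k * n + z) * k ^ j + v\<close> are \<open>block j v (average y) n\<close>. They are
  eventually periodic in \<open>v\<close> with uniform bounds, and the value for the block
  \<open>1\<close> occurs beyond the preperiod for all large \<open>j\<close>.\<close>

lemma block_average_vanishes:
  assumes y: "y \<in> Y"
  shows "block 1 1 (average y) = (\<lambda>_. 0)"
proof
  fix n
  obtain B P where P: "0 < P" and "\<forall>j v. B + d \<le> k ^ j \<longrightarrow> B \<le> v \<longrightarrow> v + P < k ^ j \<longrightarrow>
      coset (perm j (v + P)) = coset (perm j v)"
    using coset_eventually_periodic by (elim exE conjE)
  then have per: "coset (perm j (v + P)) = coset (perm j v)"
    if "B + d \<le> k ^ j" "B \<le> v" "v + P < k ^ j" for j v
    using that by simp
  have block: "average y ((k * n + z) * k ^ j + v) = block j v (average y) n" for j v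
    by (simp add: block_def sample_def algebra_simps)
  have large: "B + d \<le> k ^ j" if "B + d \<le> j" for j
  proof -
    have "j < 2 ^ j" by simp
    also have "\<dots> \<le> k ^ j" using k by (intro power_mono) auto
    finally show ?thesis using that by simp
  qed
  show "block 1 1 (average y) n = 0"
  proof (rule periodic_blocks_vanish [OF orth_periodic_average [OF y] P k])
    fix j v assume j: "Suc (B + d) \<le> j" and v: "B \<le> v" "v + P < k ^ j"
    show "average y ((k * n + z) * k ^ j + (v + P)) = average y ((k * n + z) * k ^ j + v)"
      unfolding block using v per [of j v] large [of j] j by (simp add: block_average [OF y])
  next
    fix j assume j: "Suc (B + d) \<le> j"
    define i where "i = j - 1"
    have i: "j = Suc i" "B + d \<le> i" using j by (simp_all add: i_def)
    obtain v where v: "k ^ i \<le> v" "v < k ^ Suc i" "\<forall>y\<in>Y. block (Suc i) v y = block 1 1 y"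
      using block_1_representative by blast
    have "block (Suc i) v (average y) n = (\<Sum>h\<in>H. block (Suc i) v (h y) n)"
      by (simp add: block_def sample_def average_def)
    also have "\<dots> = (\<Sum>h\<in>H. block 1 1 (h y) n)"
      using v(3) H_in_Y [OF _ y] by simp
    also have "\<dots> = block 1 1 (average y) n"
      by (simp add: block_def sample_def average_def)
    finally show "\<exists>v. B \<le> v \<and> v < k ^ j \<and> average y ((k * n + z) * k ^ j + v) = block 1 1 (average y) n"
      unfolding block i(1) using v(1,2) large [OF i(2)] by (intro exI [of _ v] conjI) simp_all
  qed
qed

text \<open>With witnesses of one length, all elements of \<open>H\<close> can occupy the same digit
  positions in \<open>cancellation\<close>.\<close>

lemma H_common_length:
  obtains J where "\<And>h. h \<in> H \<Longrightarrow> \<exists>c. cube_at J c (\<lambda>W. if W = {1..d} then h else id)"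
proof -
  have "\<forall>h\<in>H. \<exists>j c. cube_at j c (\<lambda>W. if W = {1..d} then h else id)"
    by (auto simp: H_def is_cube_def)
  then obtain j where j: "\<And>h. h \<in> H \<Longrightarrow> \<exists>c. cube_at (j h) c (\<lambda>W. if W = {1..d} then h else id)"
    by metis
  have "j h \<le> Max (j ` H)" if "h \<in> H" for h
    using finite_H that by simp
  then have "\<exists>c. cube_at (Max (j ` H)) c (\<lambda>W. if W = {1..d} then h else id)" if "h \<in> H" for h
    using j [OF that] cube_at_mono that by blast
  then show thesis by (rule that)
qed

end

section \<open>Sums over cubes of integers\<close>

text \<open>The offsets \<open>r\<close> hold the carries that arise when low digits are split
  off.\<close>

definition int_cubes :: "nat \<Rightarrow> (nat set \<Rightarrow> int) \<Rightarrow> nat \<Rightarrow> (nat \<Rightarrow> int) set" where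
  "int_cubes d r N = {c \<in> {0..d} \<rightarrow>\<^sub>E UNIV. \<forall>W\<subseteq>{1..d}.
     0 \<le> vertex c W + r W \<and> vertex c W + r W < int N}"

text \<open>For \<open>r = 0\<close> this is an unnormalised Gowers inner product on
  \<open>[N]\<close>, with a separate function at each vertex and any conjugation included in
  \<open>F\<close>.\<close>

definition cube_sum :: "nat \<Rightarrow> (nat set \<Rightarrow> nat \<Rightarrow> complex) \<Rightarrow> (nat set \<Rightarrow> int) \<Rightarrow> nat \<Rightarrow> complex" where
  "cube_sum d F r N = (\<Sum>c\<in>int_cubes d r N. \<Prod>W\<in>Pow {1..d}. F W (nat (vertex c W + r W)))"

text \<open>A cube is determined by a vertex \<open>V\<close> and the neighbours of \<open>V\<close>.\<close>

lemma int_cubes_boundary: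
  assumes V: "V \<subseteq> {1..d}"
  shows "finite {c \<in> int_cubes d r N. int M \<le> vertex c V + r V}"
    and "card {c \<in> int_cubes d r N. int M \<le> vertex c V + r V} \<le> (N - M) * N ^ d"
proof -
  let ?C = "{c \<in> int_cubes d r N. int M \<le> vertex c V + r V}"
  \<comment> \<open>\<open>nb i\<close> is the neighbour of \<open>V\<close> across edge
    \<open>i\<close>; \<open>\<phi>\<close> records the value at \<open>V\<close> in coordinate
    \<open>0\<close> and those at the neighbours in the others.\<close>
  define nb where "nb i = (if i \<in> V then V - {i} else insert i V)" for i
  define \<phi> where "\<phi> c = (\<lambda>i\<in>{0..d}. if i = 0 then vertex c V + r V else vertex c (nb i) + r (nb i))" for c
  define T where "T i = (if i = 0 then {int M..<int N} else {0..<int N})" for i :: nat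
  have nb: "nb i \<subseteq> {1..d}" if "i \<in> {1..d}" for i using V that by (auto simp: nb_def)
  have finV: "finite V" using V finite_subset by blast
  have vnb: "vertex c (nb i) = vertex c V + (if i \<in> V then - c i else c i)" for c i
    using finV by (simp add: nb_def vertex_def sum_diff1)
  have "inj_on \<phi> ?C"
  proof (rule inj_onI)
    fix c c' assume c: "c \<in> ?C" and c': "c' \<in> ?C" and eq: "\<phi> c = \<phi> c'"
    have v: "vertex c V = vertex c' V"
      using fun_cong [OF eq, of 0] by (simp add: \<phi>_def)
    have i: "c i = c' i" if "i \<in> {1..d}" for i
      using fun_cong [OF eq, of i] that v by (auto simp: \<phi>_def vnb split: if_splits)
    have "sum c V = sum c' V" using i V by (intro sum.cong) auto
    then have 0: "c 0 = c' 0" using v by (simp add: vertex_def)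
    have "c x = c' x" if "x \<in> {0..d}" for x
      using i [of x] 0 that by (cases "x = 0") auto
    then show "c = c'"
      using c c' unfolding int_cubes_def by (intro PiE_ext [of c "{0..d}" "\<lambda>_. UNIV" c']) auto
  qed
  moreover have "\<phi> ` ?C \<subseteq> PiE {0..d} T"
    using V nb by (auto simp: \<phi>_def T_def int_cubes_def PiE_def extensional_def)
  moreover have fin: "finite (PiE {0..d} T)" by (intro finite_PiE) (auto simp: T_def)
  ultimately show "finite ?C" and "card ?C \<le> (N - M) * N ^ d"
  proof -
    assume *: "inj_on \<phi> ?C" "\<phi> ` ?C \<subseteq> PiE {0..d} T"
    show "finite ?C" using * fin by (rule inj_on_finite)
    have "card ?C \<le> card (PiE {0..d} T)" using * fin by (rule card_inj_on_le)
    also have "\<dots> = (\<Prod>i\<in>{0..d}. card (T i))" by (simp add: card_PiE)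
    also have "\<dots> = card (T 0) * (\<Prod>i\<in>{1..d}. card (T i))"
      by (simp add: prod.atLeast_Suc_atMost)
    also have "(\<Prod>i\<in>{1..d}. card (T i)) = (\<Prod>i\<in>{1..d}. N)"
      by (intro prod.cong) (auto simp: T_def)
    moreover have "card (T 0) = N - M" by (simp add: T_def)
    ultimately show "card ?C \<le> (N - M) * N ^ d" by simp
  qed
qed

lemma finite_int_cubes: "finite (int_cubes d r N)"
proof -
  have "int_cubes d r N = {c \<in> int_cubes d r N. int 0 \<le> vertex c {} + r {}}"
    by (auto simp: int_cubes_def)
  then show ?thesis using int_cubes_boundary(1) [of "{}" d r N 0] by simp
qed

lemma cube_sum_zero: "cube_sum d F r 0 = 0"
  by (auto simp: cube_sum_def int_cubes_def intro!: sum.neutral)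

text \<open>A cube counted for \<open>N\<close> but not for \<open>M\<close> has one of its
  \<open>2 ^ d\<close> vertices in \<open>[M, N)\<close>, and for each vertex there are at most
  \<open>(N - M) * N ^ d\<close> such cubes.\<close>

lemma cube_sum_boundary:
  assumes bd: "\<And>W n. W \<subseteq> {1..d} \<Longrightarrow> norm (F W n) \<le> C" and M: "M \<le> N"
  shows "norm (cube_sum d F r N - cube_sum d F r M) \<le> C ^ 2 ^ d * (2 ^ d * real (N - M) * real N ^ d)"
proof -
  let ?P = "\<lambda>c. \<Prod>W\<in>Pow {1..d}. F W (nat (vertex c W + r W))"
  let ?B = "\<lambda>V. {c \<in> int_cubes d r N. int M \<le> vertex c V + r V}"
  have C: "0 \<le> C" using order_trans [OF norm_ge_zero bd [of "{}" 0]] by simp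
  have sub: "int_cubes d r M \<subseteq> int_cubes d r N"
  proof
    fix c assume c: "c \<in> int_cubes d r M"
    have "vertex c W + r W < int N" if "W \<subseteq> {1..d}" for W
    proof -
      have "vertex c W + r W < int M" using c that by (simp add: int_cubes_def)
      then show ?thesis using M by simp
    qed
    then show "c \<in> int_cubes d r N" using c by (simp add: int_cubes_def)
  qed
  have diff: "int_cubes d r N - int_cubes d r M \<subseteq> (\<Union>V\<in>Pow {1..d}. ?B V)"
  proof
    fix c assume c: "c \<in> int_cubes d r N - int_cubes d r M"
    then have 1: "c \<in> {0..d} \<rightarrow>\<^sub>E UNIV"
      and N: "\<forall>V\<subseteq>{1..d}. 0 \<le> vertex c V + r V \<and> vertex c V + r V < int N"
      by (simp_all add: int_cubes_def)
    have "\<not> (\<forall>V\<subseteq>{1..d}. 0 \<le> vertex c V + r V \<and> vertex c V + r V < int M)"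
    proof
      assume "\<forall>V\<subseteq>{1..d}. 0 \<le> vertex c V + r V \<and> vertex c V + r V < int M"
      then have "c \<in> int_cubes d r M" using 1 by (simp add: int_cubes_def)
      then show False using c by simp
    qed
    with N obtain V where V: "V \<subseteq> {1..d}" "int M \<le> vertex c V + r V"
      by (meson not_le)
    then show "c \<in> (\<Union>V\<in>Pow {1..d}. ?B V)" using c by (intro UN_I [of V]) simp_all
  qed
  have "cube_sum d F r N - cube_sum d F r M = sum ?P (int_cubes d r N - int_cubes d r M)"
    unfolding cube_sum_def by (rule sum_diff [OF finite_int_cubes sub, symmetric])
  also have "norm \<dots> \<le> (\<Sum>c\<in>int_cubes d r N - int_cubes d r M. C ^ 2 ^ d)"
  proof (rule sum_norm_le)
    fix c
    have "norm (?P c) \<le> (\<Prod>W\<in>Pow {1..d}. C)"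
      unfolding prod_norm [symmetric] using bd by (intro prod_mono) auto
    then show "norm (?P c) \<le> C ^ 2 ^ d" by (simp add: card_Pow)
  qed
  also have "\<dots> = C ^ 2 ^ d * real (card (int_cubes d r N - int_cubes d r M))" by simp
  finally have main: "norm (cube_sum d F r N - cube_sum d F r M) \<le>
      C ^ 2 ^ d * real (card (int_cubes d r N - int_cubes d r M))" .
  have "card (int_cubes d r N - int_cubes d r M) \<le> card (\<Union>V\<in>Pow {1..d}. ?B V)"
    using diff by (intro card_mono) (auto simp: finite_int_cubes)
  also have "\<dots> \<le> (\<Sum>V\<in>Pow {1..d}. card (?B V))" by (rule card_UN_le) simp
  also have "\<dots> \<le> (\<Sum>V\<in>Pow {1..d}. (N - M) * N ^ d)"
    using int_cubes_boundary(2) by (intro sum_mono) auto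
  also have "\<dots> = 2 ^ d * (N - M) * N ^ d" by (simp add: card_Pow)
  finally have "real (card (int_cubes d r N - int_cubes d r M)) \<le> real (2 ^ d * (N - M) * N ^ d)"
    by (simp only: of_nat_le_iff)
  also have "\<dots> = 2 ^ d * real (N - M) * real N ^ d" by simp
  finally show ?thesis
    using C by (intro order_trans [OF main] mult_left_mono) simp_all
qed

lemma vertex_cong: "c 0 = c' 0 \<Longrightarrow> (\<And>i. i \<in> W \<Longrightarrow> c i = c' i) \<Longrightarrow> vertex c W = vertex c' W"
  by (simp add: vertex_def)

text \<open>Every coordinate is divided by \<open>K\<close> with remainder. At each vertex the
  remainders and \<open>r\<close> add up to a number that is divided again: its remainder selects a
  section of \<open>F W\<close>, and its quotient is the carry, which becomes the new
  offset.\<close>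

lemma cube_sum_recursion:
  assumes K: "0 < K"
  shows "cube_sum d F r (K * N) = (\<Sum>e\<in>{0..d} \<rightarrow>\<^sub>E {0..<int K}.
    cube_sum d (\<lambda>W. sample K (nat ((vertex e W + r W) mod int K)) (F W))
      (\<lambda>W. (vertex e W + r W) div int K) N)"
proof -
  define E where "E = {0..d} \<rightarrow>\<^sub>E {0..<int K}"
  define q where "q e W = (vertex e W + r W) div int K" for e W
  define \<rho> where "\<rho> e W = (vertex e W + r W) mod int K" for e W
  define join where "join = (\<lambda>(e, c). \<lambda>i\<in>{0..d}. int K * c i + e i)"
  define split where "split c = (\<lambda>i\<in>{0..d}. c i mod int K, \<lambda>i\<in>{0..d}. c i div int K)" for c
  have finE: "finite E" by (auto simp: E_def intro: finite_PiE)
  have vj: "vertex (join (e, c)) W = int K * vertex c W + vertex e W" if "W \<subseteq> {1..d}" for e c W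
  proof -
    have "vertex (join (e, c)) W = vertex (\<lambda>i. int K * c i + e i) W"
      using that by (intro vertex_cong) (auto simp: join_def)
    then show ?thesis by (simp add: vertex_def sum.distrib sum_distrib_left algebra_simps)
  qed
  have vjr: "vertex (join (e, c)) W + r W = int K * (vertex c W + q e W) + \<rho> e W"
    if "W \<subseteq> {1..d}" for e c W
    by (simp only: vj [OF that] q_def \<rho>_def distrib_left add.assoc mult_div_mod_eq)
  have \<rho>: "0 \<le> \<rho> e W" "\<rho> e W < int K" for e W using K by (simp_all add: \<rho>_def)
  \<comment> \<open>As \<open>y\<close> is a remainder, the quotient \<open>x\<close> alone decides
    whether the number lies in \<open>[0, K * N)\<close>.\<close>
  have range: "0 \<le> int K * x + y \<and> int K * x + y < int (K * N) \<longleftrightarrow> 0 \<le> x \<and> x < int N"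
    if y: "0 \<le> y" "y < int K" for x y
  proof -
    consider "x < 0" | "0 \<le> x" "x < int N" | "0 \<le> x" "int N \<le> x" by linarith
    then show ?thesis
    proof cases
      case 1
      then have "int K * x \<le> int K * (- 1)" by (intro mult_left_mono) auto
      then show ?thesis using 1 y by simp
    next
      case 2
      then have "int K * (x + 1) \<le> int K * int N" by (intro mult_left_mono) auto
      moreover have "0 \<le> int K * x" using 2 by simp
      ultimately show ?thesis using 2 y by (simp add: distrib_left)
    next
      case 3
      then have "int K * int N \<le> int K * x" by (intro mult_left_mono) auto
      then have "\<not> int K * x + y < int (K * N)" using y unfolding of_nat_mult by linarith
      then show ?thesis using 3(2) by linarith
    qed
  qed
  have mem: "join (e, c) \<in> int_cubes d r (K * N) \<longleftrightarrow> c \<in> int_cubes d (q e) N"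
    if c: "c \<in> {0..d} \<rightarrow>\<^sub>E UNIV" for e c
  proof -
    have "join (e, c) \<in> {0..d} \<rightarrow>\<^sub>E UNIV" by (simp add: join_def)
    moreover have "(\<forall>W\<subseteq>{1..d}. 0 \<le> vertex (join (e, c)) W + r W \<and> vertex (join (e, c)) W + r W < int (K * N)) \<longleftrightarrow>
        (\<forall>W\<subseteq>{1..d}. 0 \<le> vertex c W + q e W \<and> vertex c W + q e W < int N)"
    proof (intro all_cong1 imp_cong refl)
      fix W assume W: "W \<subseteq> {1..d}"
      show "0 \<le> vertex (join (e, c)) W + r W \<and> vertex (join (e, c)) W + r W < int (K * N) \<longleftrightarrow>
        0 \<le> vertex c W + q e W \<and> vertex c W + q e W < int N"
        unfolding vjr [OF W] by (rule range [OF \<rho>])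
    qed
    ultimately show ?thesis using c unfolding int_cubes_def mem_Collect_eq by (simp only:)
  qed
  have js: "join (split c) = c" if "c \<in> {0..d} \<rightarrow>\<^sub>E UNIV" for c
  proof
    fix i show "join (split c) i = c i"
      using PiE_arb [OF that, of i] by (simp add: join_def split_def)
  qed
  have sj: "split (join (e, c)) = (e, c)" if e: "e \<in> E" and c: "c \<in> {0..d} \<rightarrow>\<^sub>E UNIV" for e c
  proof -
    have "(int K * c i + e i) mod int K = e i" "(int K * c i + e i) div int K = c i" if "i \<in> {0..d}" for i
      using PiE_mem [OF e [unfolded E_def] that] by simp_all
    then have "(if i \<in> {0..d} then (int K * c i + e i) mod int K else undefined) = e i"
      "(if i \<in> {0..d} then (int K * c i + e i) div int K else undefined) = c i" for i
      using PiE_arb [OF e [unfolded E_def], of i] PiE_arb [OF c, of i] by simp_all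
    then show ?thesis
      unfolding split_def join_def by (simp add: fun_eq_iff restrict_def cong: if_cong)
  qed
  have "(\<Sum>e\<in>E. cube_sum d (\<lambda>W. sample K (nat (\<rho> e W)) (F W)) (q e) N) =
    (\<Sum>(e, c)\<in>Sigma E (\<lambda>e. int_cubes d (q e) N).
       \<Prod>W\<in>Pow {1..d}. sample K (nat (\<rho> e W)) (F W) (nat (vertex c W + q e W)))"
    unfolding cube_sum_def by (rule sum.Sigma) (use finE finite_int_cubes in auto)
  also have "\<dots> = (\<Sum>c\<in>int_cubes d r (K * N). \<Prod>W\<in>Pow {1..d}. F W (nat (vertex c W + r W)))"
  proof (rule sum.reindex_bij_witness [of _ split join])
    fix p assume p: "p \<in> Sigma E (\<lambda>e. int_cubes d (q e) N)"
    obtain e c where ec: "p = (e, c)" by fastforce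
    have e: "e \<in> E" and c: "c \<in> int_cubes d (q e) N" using p by (auto simp: ec)
    have c': "c \<in> {0..d} \<rightarrow>\<^sub>E UNIV" using c by (simp add: int_cubes_def)
    show "split (join p) = p" unfolding ec by (rule sj [OF e c'])
    show "join p \<in> int_cubes d r (K * N)" unfolding ec using mem [OF c', of e] c by simp
    have "F W (nat (vertex (join (e, c)) W + r W)) =
        sample K (nat (\<rho> e W)) (F W) (nat (vertex c W + q e W))" if W: "W \<subseteq> {1..d}" for W
    proof -
      have "0 \<le> vertex c W + q e W" using c W by (auto simp: int_cubes_def)
      then have "nat (int K * (vertex c W + q e W) + \<rho> e W) =
          K * nat (vertex c W + q e W) + nat (\<rho> e W)"
        using \<rho> by (simp add: nat_add_distrib nat_mult_distrib)
      then show ?thesis by (simp add: vjr [OF W] sample_def)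
    qed
    then show "(\<Prod>W\<in>Pow {1..d}. F W (nat (vertex (join p) W + r W))) =
        (case p of (e, c) \<Rightarrow> \<Prod>W\<in>Pow {1..d}. sample K (nat (\<rho> e W)) (F W) (nat (vertex c W + q e W)))"
      unfolding ec by (auto intro!: prod.cong)
  next
    fix c assume c: "c \<in> int_cubes d r (K * N)"
    have c': "c \<in> {0..d} \<rightarrow>\<^sub>E UNIV" using c by (simp add: int_cubes_def)
    show "join (split c) = c" by (rule js [OF c'])
    have "fst (split c) \<in> E" "snd (split c) \<in> {0..d} \<rightarrow>\<^sub>E UNIV"
      using K by (auto simp: split_def E_def)
    then show "split c \<in> Sigma E (\<lambda>e. int_cubes d (q e) N)"
      using mem [of "snd (split c)" "fst (split c)"] js [OF c'] c by (cases "split c") auto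
  qed
  finally show ?thesis
    unfolding q_def [abs_def] \<rho>_def [abs_def] E_def cube_sum_def [of d F r] by (rule sym)
qed

lemma funpow_cnj_sum: "(cnj ^^ m) (\<Sum>x\<in>A. f x) = (\<Sum>x\<in>A. (cnj ^^ m) (f x))"
  by (induction m) simp_all

lemma norm_funpow_cnj [simp]: "norm ((cnj ^^ m) x) = norm x"
  by (induction m) simp_all

text \<open>All factors but the one at \<open>D\<close> can be taken out of the sum over
  \<open>H\<close>.\<close>

lemma sum_cube_sum_single_vertex:
  assumes D: "D \<subseteq> {1..d}"
    and G: "\<And>h W. W \<noteq> D \<Longrightarrow> G h W = G' W" and zero: "\<And>n. (\<Sum>h\<in>H. G h D n) = 0"
  shows "(\<Sum>h\<in>H. cube_sum d (G h) r N) = 0"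
proof -
  have "(\<Sum>h\<in>H. cube_sum d (G h) r N) =
      (\<Sum>c\<in>int_cubes d r N. \<Sum>h\<in>H. \<Prod>W\<in>Pow {1..d}. G h W (nat (vertex c W + r W)))"
    unfolding cube_sum_def by (rule sum.swap)
  also have "\<dots> = (\<Sum>c\<in>int_cubes d r N. \<Sum>h\<in>H. G h D (nat (vertex c D + r D)) *
      (\<Prod>W\<in>Pow {1..d} - {D}. G' W (nat (vertex c W + r W))))"
  proof (intro sum.cong refl)
    fix c h
    have "(\<Prod>W\<in>Pow {1..d} - {D}. G h W (nat (vertex c W + r W))) =
        (\<Prod>W\<in>Pow {1..d} - {D}. G' W (nat (vertex c W + r W)))"
      by (intro prod.cong) (auto simp: G)
    then show "(\<Prod>W\<in>Pow {1..d}. G h W (nat (vertex c W + r W))) = G h D (nat (vertex c D + r D)) *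
      (\<Prod>W\<in>Pow {1..d} - {D}. G' W (nat (vertex c W + r W)))"
      using D by (subst prod.remove [of _ D]) auto
  qed
  also have "\<dots> = 0" by (simp add: zero flip: sum_distrib_right)
  finally show ?thesis .
qed

section \<open>Cancelling cells and the power saving\<close>

context kernel_cube
begin

lemma closed_power: "f \<in> \<K> \<Longrightarrow> v < k ^ j \<Longrightarrow> sample (k ^ j) v f \<in> \<K>"
proof (induction j arbitrary: v)
  case (Suc j)
  have "v div k ^ j < k"
    using Suc.prems k by (simp add: less_mult_imp_div_less)
  moreover have "v mod k ^ j < k ^ j" using k by simp
  ultimately have "sample k (v div k ^ j) (sample (k ^ j) (v mod k ^ j) f) \<in> \<K>"
    using closed Suc by blast
  then show ?case by (simp add: sample_sample)
qed simp

lemma leading_digit_less: "v < k ^ j \<Longrightarrow> z * k ^ j + v < k ^ Suc j"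
proof -
  assume "v < k ^ j"
  then have "z * k ^ j + v < Suc z * k ^ j" by simp
  also have "\<dots> \<le> k * k ^ j" using z by (intro mult_right_mono) auto
  finally show ?thesis by simp
qed

lemma block_of_kernel: 
  assumes "f \<in> \<K>" "v < k ^ j"
  shows "block j v f \<in> Y"
proof -
  have "block j v f = sample k z (sample (k ^ j) v f)"
    by (simp add: block_def sample_sample mult.commute)
  then show ?thesis using closed_power [OF assms] by (simp add: Y_def)
qed

text \<open>Carries and the numbers \<open>card W\<close> are at most \<open>d\<close>, so
  \<open>d\<close> digits are enough for each of them.\<close>

lemma d_less: "d < k ^ d"
proof -
  have "d < 2 ^ d" by simp
  also have "\<dots> \<le> k ^ d" using k by (intro power_mono) auto
  finally show ?thesis .
qed

text \<open>The cubes used here have the digit blocks \<open>z |W| z 1 z x z r\<close> at the vertex \<open>W\<close>, where \<open>x\<close> is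
  the vertex of a cube that witnesses an element of \<open>H\<close>. The block \<open>z r\<close> absorbs the carry and
  \<open>|W|\<close> makes the edge vectors nonnegative.\<close>

lemma cancellation:
  "\<exists>m>0. \<forall>f r. (\<forall>W\<subseteq>{1..d}. f W \<in> \<K> \<and> r W \<in> {0..int d}) \<longrightarrow>
      (\<exists>E. E \<noteq> {} \<and> E \<subseteq> {0..d} \<rightarrow>\<^sub>E {0..<int (k ^ m)} \<and>
        (\<forall>N. (\<Sum>e\<in>E. cube_sum d
          (\<lambda>W. (cnj ^^ card W) \<circ> sample (k ^ m) (nat ((vertex e W + r W) mod int (k ^ m))) (f W))
          (\<lambda>W. (vertex e W + r W) div int (k ^ m)) N) = 0))"
proof -
  obtain J where J: "\<And>h. h \<in> H \<Longrightarrow> \<exists>c. cube_at J c (\<lambda>W. if W = {1..d} then h else id)"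
    using H_common_length by blast
  then obtain cc where cc: "\<And>h. h \<in> H \<Longrightarrow> cube_at J (cc h) (\<lambda>W. if W = {1..d} then h else id)"
    by metis
  \<comment> \<open>\<open>j1\<close>, \<open>j2\<close> and \<open>j3\<close> are the lengths of
    \<open>x z r\<close>, \<open>1 z x z r\<close> and \<open>|W| z 1 z x z r\<close>;
    \<open>K\<close> has one more digit for the leading \<open>z\<close>.\<close>
  define j1 where "j1 = Suc (J + d)"
  define j2 where "j2 = Suc (1 + j1)"
  define j3 where "j3 = Suc (d + j2)"
  define K where "K = k ^ Suc j3"
  \<comment> \<open>\<open>a\<close> is the number whose blocks \<open>|W|\<close>, \<open>x\<close>
    and \<open>r\<close> are zero. In \<open>e h\<close> every edge adds \<open>1\<close> to the
    block \<open>|W|\<close> through \<open>k ^ Suc j2\<close>.\<close>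
  define a where "a = z * k ^ j3 + (z * k ^ j2 + (k ^ Suc j1 + z * k ^ j1)) + z * k ^ d"
  define e where "e h = (\<lambda>i\<in>{0..d}. (if i = 0 then int a else int (k ^ Suc j2)) + cc h i * int (k ^ Suc d))" for h
  define u where "u x w r = z * k ^ j3 + (w * k ^ Suc j2 + z * k ^ j2 + (1 * k ^ Suc j1 + z * k ^ j1 +
    (x * k ^ Suc d + z * k ^ d + r)))" for x w r
  have x: "0 \<le> vertex (cc h) W" "vertex (cc h) W < int k ^ J" "nat (vertex (cc h) W) < k ^ J"
    "perm J (nat (vertex (cc h) W)) = (if W = {1..d} then h else id)" if "h \<in> H" "W \<subseteq> {1..d}" for h W
    using cc [OF that(1)] that(2) nat_less_power by (auto simp: cube_at_def)
  have one: "1 < k ^ 1" using k by simp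
  have u_less: "u x w r < K" if "x < k ^ J" "w < k ^ d" "r < k ^ d" for x w r
    unfolding u_def K_def j3_def j2_def j1_def
    by (intro leading_digit_less concat_less that one)
  \<comment> \<open>The words act from right to left: \<open>r\<close> takes \<open>f\<close> into
    \<open>Y\<close>, \<open>x\<close> then acts as a permutation, and the block \<open>1\<close>,
    under which sums over \<open>H\<close> vanish, comes next.\<close>
  have sample_u: "sample K (u x w r) f = block d w (block 1 1 (block J x (block d r f)))" for x w r f
    unfolding block_block unfolding block_def K_def u_def j3_def j2_def j1_def by simp
  have ve: "vertex (e h) W = int (k ^ Suc d) * vertex (cc h) W + int a + int (card W) * int (k ^ Suc j2)"
    if "W \<subseteq> {1..d}" for h W
  proof -
    have W: "0 \<notin> W" "W \<subseteq> {0..d}" using that by auto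
    have "(\<Sum>i\<in>W. e h i) = (\<Sum>i\<in>W. int (k ^ Suc j2) + cc h i * int (k ^ Suc d))"
      using W by (intro sum.cong) (auto simp: e_def)
    moreover have "e h 0 = int a + cc h 0 * int (k ^ Suc d)" by (simp add: e_def)
    ultimately show ?thesis
      unfolding vertex_def by (simp only: sum.distrib sum_distrib_right [symmetric] sum_constant)
        (simp only: distrib_left ac_simps)
  qed
  have vu: "vertex (e h) W + int r = int (u (nat (vertex (cc h) W)) (card W) r)"
    if "h \<in> H" "W \<subseteq> {1..d}" for h W r
  proof -
    define y where "y = nat (vertex (cc h) W)"
    have y: "vertex (cc h) W = int y" using x(1) [OF that] by (simp add: y_def)
    show ?thesis unfolding ve [OF that(2)] y nat_int u_def a_def by (simp add: algebra_simps)
  qed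
  have card_W: "card W \<le> d" if "W \<subseteq> {1..d}" for W
    using card_mono [OF _ that] by simp
  have e_range: "e h \<in> {0..d} \<rightarrow>\<^sub>E {0..<int K}" if h: "h \<in> H" for h
  proof (rule PiE_I)
    fix i assume i: "i \<in> {0..d}"
    show "e h i \<in> {0..<int K}"
    proof (cases "i = 0")
      case True
      have "u (nat (vertex (cc h) {})) (card ({} :: nat set)) 0 < K"
        using x(3) [OF h, of "{}"] k by (intro u_less) auto
      moreover have "vertex (e h) {} + int 0 = int (u (nat (vertex (cc h) {})) (card ({} :: nat set)) 0)"
        by (rule vu [OF h]) simp
      ultimately show ?thesis using True by (simp only: vertex_empty) simp
    next
      case False
      \<comment> \<open>An edge of the witness may be as low as \<open>- k ^ J\<close>. Shifted by
        \<open>Suc d\<close> digits it has size at most \<open>k ^ j1\<close>, which the summand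
        \<open>k ^ Suc j2\<close> outweighs.\<close>
      have "cc h i = vertex (cc h) {i} - vertex (cc h) {}" by (simp add: vertex_def)
      then have c: "- (int k ^ J) \<le> cc h i" "cc h i \<le> int k ^ J"
        using x(1,2) [OF h, of "{i}"] x(1,2) [OF h, of "{}"] False i by auto
      have "int k ^ J * int (k ^ Suc d) = int (k ^ j1)" by (simp add: j1_def power_add)
      then have c': "- int (k ^ j1) \<le> cc h i * int (k ^ Suc d)" "cc h i * int (k ^ Suc d) \<le> int (k ^ j1)"
        using mult_right_mono [OF c(1), of "int (k ^ Suc d)"] mult_right_mono [OF c(2), of "int (k ^ Suc d)"]
        by simp_all
      have "k ^ j1 \<le> k ^ Suc j2" using k by (intro power_increasing) (auto simp: j2_def)
      moreover have "2 * k ^ Suc j2 \<le> k * k ^ Suc j2" using k by (intro mult_right_mono) auto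
      moreover have "k * k ^ Suc j2 = k ^ Suc (Suc j2)" by simp
      moreover have "k ^ Suc (Suc j2) < K"
        unfolding K_def j3_def using k d by (intro power_strict_increasing) auto
      ultimately have "int (k ^ j1) \<le> int (k ^ Suc j2)" "int (k ^ Suc j2) + int (k ^ Suc j2) < int K"
        by linarith+
      then show ?thesis using c' i False by (simp add: e_def del: power_Suc of_nat_power)
    qed
  qed (simp add: e_def)
  \<comment> \<open>An element of \<open>H\<close> can be read off from its witness at the vertex
    \<open>{1..d}\<close>, so distinct elements give distinct cells.\<close>
  have inj: "inj_on e H"
  proof (rule inj_onI)
    fix h h' assume h: "h \<in> H" "h' \<in> H" and eq: "e h = e h'"
    have "cc h i = cc h' i" if "i \<in> {0..d}" for i
      using fun_cong [OF eq, of i] that k by (simp add: e_def split: if_splits)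
    then have "vertex (cc h) {1..d} = vertex (cc h') {1..d}"
      by (intro vertex_cong) auto
    then show "h = h'" using x(4) [OF h(1), of "{1..d}"] x(4) [OF h(2), of "{1..d}"] by simp
  qed
  show ?thesis
  proof (intro exI [of _ "Suc j3"] conjI allI impI)
    fix f :: "nat set \<Rightarrow> nat \<Rightarrow> complex" and r :: "nat set \<Rightarrow> int"
    assume fr: "\<forall>W\<subseteq>{1..d}. f W \<in> \<K> \<and> r W \<in> {0..int d}"
    have f: "f W \<in> \<K>" and r: "r W \<in> {0..int d}" if "W \<subseteq> {1..d}" for W
      using fr that by blast+
    define y where "y W = block d (nat (r W)) (f W)" for W
    have r': "nat (r W) < k ^ d" "r W = int (nat (r W))" if "W \<subseteq> {1..d}" for W
      using r [OF that] d_less by auto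
    have y: "y W \<in> Y" if "W \<subseteq> {1..d}" for W
      unfolding y_def by (intro block_of_kernel f r' that)
    define G where "G h W = (cnj ^^ card W) \<circ>
      block d (card W) (block 1 1 (if W = {1..d} then h (y W) else y W))" for h W
    \<comment> \<open>At each vertex the digits and \<open>r W\<close> add up to less than
      \<open>K\<close>. Hence all new offsets are \<open>0\<close>, and the cells of different
      \<open>h\<close> differ only in the function at \<open>{1..d}\<close>.\<close>
    have cell: "cube_sum d
          (\<lambda>W. (cnj ^^ card W) \<circ> sample K (nat ((vertex (e h) W + r W) mod int K)) (f W))
          (\<lambda>W. (vertex (e h) W + r W) div int K) N = cube_sum d (G h) (\<lambda>_. 0) N"
      if h: "h \<in> H" for h N
    proof -
      have "(vertex (e h) W + r W) div int K = 0 \<and>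
          sample K (nat ((vertex (e h) W + r W) mod int K)) (f W) =
          block d (card W) (block 1 1 (if W = {1..d} then h (y W) else y W))" if W: "W \<subseteq> {1..d}" for W
      proof -
        let ?u = "u (nat (vertex (cc h) W)) (card W) (nat (r W))"
        have eq: "vertex (e h) W + r W = int ?u"
          using vu [OF h W, of "nat (r W)"] r'(2) [OF W] by simp
        have less: "?u < K"
          using x(3) [OF h W] card_W [OF W] d_less r'(1) [OF W] by (intro u_less) auto
        have "block J (nat (vertex (cc h) W)) (y W) = perm J (nat (vertex (cc h) W)) (y W)"
          using y [OF W] by (simp add: perm_def)
        then have "sample K ?u (f W) = block d (card W) (block 1 1 (if W = {1..d} then h (y W) else y W))"
          unfolding sample_u y_def [symmetric] x(4) [OF h W] by simp
        then show ?thesis unfolding eq using less by (simp flip: of_nat_mod of_nat_div)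
      qed
      note * = this
      have "int_cubes d (\<lambda>W. (vertex (e h) W + r W) div int K) N = int_cubes d (\<lambda>_. 0) N"
        unfolding int_cubes_def using * by auto
      then show ?thesis
        unfolding cube_sum_def G_def using * by (intro sum.cong prod.cong refl) auto
    qed
    have zero: "(\<Sum>h\<in>H. G h {1..d} n) = 0" for n
    proof -
      \<comment> \<open>This is the argument left after the outer block, which spells
        \<open>card {1..d} = d\<close>.\<close>
      define n' where "n' = k ^ Suc d * n + (z * k ^ d + d)"
      have "(\<Sum>h\<in>H. G h {1..d} n) = (cnj ^^ d) (\<Sum>h\<in>H. block 1 1 (h (y {1..d})) n')"
        unfolding funpow_cnj_sum by (simp add: G_def block_def [of d] sample_def n'_def)
      also have "(\<Sum>h\<in>H. block 1 1 (h (y {1..d})) n') = block 1 1 (average (y {1..d})) n'"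
        by (simp add: block_def sample_def average_def)
      also have "\<dots> = 0" by (subst block_average_vanishes) (auto intro: y)
      also have "(cnj ^^ d) 0 = 0" by (induction d) simp_all
      finally show ?thesis .
    qed
    have "(\<Sum>h\<in>H. cube_sum d (G h) (\<lambda>_. 0) N) = 0" for N
    proof (rule sum_cube_sum_single_vertex [of "{1..d}"])
      show "G h W = G id W" if "W \<noteq> {1..d}" for h W
        using that by (simp only: G_def if_False)
    qed (simp_all only: zero subset_refl)
    then have "(\<Sum>e'\<in>e ` H. cube_sum d
          (\<lambda>W. (cnj ^^ card W) \<circ> sample K (nat ((vertex e' W + r W) mod int K)) (f W))
          (\<lambda>W. (vertex e' W + r W) div int K) N) = 0" for N
      using inj by (simp add: sum.reindex cell)
    then show "\<exists>E. E \<noteq> {} \<and> E \<subseteq> {0..d} \<rightarrow>\<^sub>E {0..<int (k ^ Suc j3)} \<and>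
        (\<forall>N. (\<Sum>e\<in>E. cube_sum d
          (\<lambda>W. (cnj ^^ card W) \<circ> sample (k ^ Suc j3) (nat ((vertex e W + r W) mod int (k ^ Suc j3))) (f W))
          (\<lambda>W. (vertex e W + r W) div int (k ^ Suc j3)) N) = 0)"
      using H_id e_range unfolding K_def [symmetric] by (intro exI [of _ "e ` H"]) auto
  qed simp
qed

text \<open>The sum is at most \<open>(d + 1) * (K - 1) + d < (d + 1) * K\<close>, so offsets stay
  in \<open>{0..d}\<close> throughout the recursion.\<close>

lemma carry_bound:
  assumes e: "e \<in> {0..d} \<rightarrow>\<^sub>E {0..<int K}" and r: "r W \<in> {0..int d}" and W: "W \<subseteq> {1..d}" and K: "0 < K"
  shows "(vertex e W + r W) div int K \<in> {0..int d}"
proof -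
  have e': "0 \<le> e i" "e i \<le> int K - 1" if "i \<in> {0..d}" for i
    using PiE_mem [OF e that] by auto
  have card: "card W \<le> d" using card_mono [OF _ W] by simp
  have "0 \<le> (\<Sum>i\<in>W. e i)" using W e' by (intro sum_nonneg) auto
  moreover have "(\<Sum>i\<in>W. e i) \<le> (\<Sum>i\<in>W. int K - 1)" using W e' by (intro sum_mono) auto
  moreover have "(\<Sum>i\<in>W. int K - 1) \<le> int d * (int K - 1)"
    using card K by (simp add: mult_right_mono)
  moreover have "0 \<le> e 0" "e 0 \<le> int K - 1" using e' [of 0] by auto
  ultimately have "0 \<le> vertex e W + r W" "vertex e W + r W < (int d + 1) * int K"
    using r by (auto simp: vertex_def algebra_simps)
  then have x: "0 \<le> (vertex e W + r W) div int K" "vertex e W + r W < (int d + 1) * int K"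
    using K by (simp_all only: pos_imp_zdiv_nonneg_iff of_nat_0_less_iff)
  have "(vertex e W + r W) div int K < int d + 1"
  proof (rule ccontr)
    assume "\<not> (vertex e W + r W) div int K < int d + 1"
    then have "(int d + 1) * int K \<le> (vertex e W + r W) div int K * int K"
      by (intro mult_right_mono) auto
    also have "\<dots> \<le> vertex e W + r W"
      using K by (simp flip: minus_mod_eq_div_mult)
    finally show False using x(2) by simp
  qed
  then show ?thesis using x(1) by simp
qed

text \<open>Induction from \<open>N div K\<close> to \<open>N\<close>. A nonempty set of the
  \<open>K ^ (d + 1)\<close> cells cancels, the other cells obey the induction hypothesis, and
  rounding \<open>N\<close> down to a multiple of \<open>K\<close> costs a boundary term of order
  \<open>N ^ d\<close>.\<close>

lemma cube_sum_decay:
  "\<exists>c s. s < real (d + 1) \<and> (\<forall>f r N. (\<forall>W\<subseteq>{1..d}. f W \<in> \<K> \<and> r W \<in> {0..int d}) \<longrightarrow>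
      norm (cube_sum d (\<lambda>W. (cnj ^^ card W) \<circ> f W) r N) \<le> c * real N powr s)"
proof -
  obtain m where m: "0 < m" and cancel: "\<forall>f r. (\<forall>W\<subseteq>{1..d}. f W \<in> \<K> \<and> r W \<in> {0..int d}) \<longrightarrow>
      (\<exists>E. E \<noteq> {} \<and> E \<subseteq> {0..d} \<rightarrow>\<^sub>E {0..<int (k ^ m)} \<and>
        (\<forall>N. (\<Sum>e\<in>E. cube_sum d
          (\<lambda>W. (cnj ^^ card W) \<circ> sample (k ^ m) (nat ((vertex e W + r W) mod int (k ^ m))) (f W))
          (\<lambda>W. (vertex e W + r W) div int (k ^ m)) N) = 0))"
    using cancellation by (elim exE conjE)
  define K where "K = k ^ m"
  have K: "2 \<le> K" using k m self_le_power [of k m] unfolding K_def by linarith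
  \<comment> \<open>\<open>a\<close> bounds the number of surviving cells, and \<open>s\<close>
    satisfies \<open>K powr s = b\<close>. Taking \<open>b\<close> strictly between \<open>a\<close>
    and \<open>K ^ (d + 1)\<close> leaves room for the boundary term, and
    \<open>b \<ge> K ^ d\<close> gives \<open>s \<ge> d\<close>.\<close>
  define a where "a = real K ^ (d + 1) - 1"
  define b where "b = a + 1 / 2"
  define s where "s = log K b"
  have Kd: "real K ^ d \<ge> 1" "real K ^ (d + 1) \<ge> 2 * real K ^ d"
    using K by (auto intro: mult_right_mono)
  have b: "b \<ge> real K ^ d" "b < real K ^ (d + 1)" "b > 0" "a \<ge> 0" using Kd by (auto simp: b_def a_def)
  have s: "s < real (d + 1)" "real d \<le> s"
  proof -
    have "b < real K powr real (d + 1)" "real K powr real d \<le> b"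
      using b K by (simp_all only: powr_realpow of_nat_0_less_iff)
    then show "s < real (d + 1)" "real d \<le> s"
      unfolding s_def using K b(3) by (simp_all only: log_less_iff le_log_iff)
  qed
  have Ks: "real K powr s = b" unfolding s_def using K b by simp
  define C1 where "C1 = max C 0 ^ 2 ^ d * (2 ^ d * real K)"
  \<comment> \<open>This solves \<open>a * c / b + C1 = c\<close>, because
    \<open>b - a = 1 / 2\<close>.\<close>
  define c where "c = 2 * b * C1"
  have C1: "C1 \<ge> 0" by (simp add: C1_def)
  have c: "c \<ge> 0" using C1 b by (simp add: c_def)
  have decay: "norm (cube_sum d (\<lambda>W. (cnj ^^ card W) \<circ> f W) r N) \<le> c * real N powr s"
    if "\<forall>W\<subseteq>{1..d}. f W \<in> \<K> \<and> r W \<in> {0..int d}" for f r N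
    using that
  proof (induction N arbitrary: f r rule: less_induct)
    case (less N)
    have f: "f W \<in> \<K>" and r: "r W \<in> {0..int d}" if "W \<subseteq> {1..d}" for W
      using less.prems that by blast+
    show ?case
    proof (cases "N = 0")
      case True
      then show ?thesis by (simp add: cube_sum_zero)
    next
      case False
      define M where "M = N div K"
      have M: "M < N" using False K by (simp add: M_def)
      let ?F = "\<lambda>W. (cnj ^^ card W) \<circ> f W"
      let ?T = "\<lambda>e. cube_sum d
          (\<lambda>W. (cnj ^^ card W) \<circ> sample K (nat ((vertex e W + r W) mod int K)) (f W))
          (\<lambda>W. (vertex e W + r W) div int K) M"
      define B where "B = {0..d} \<rightarrow>\<^sub>E {0..<int K}"
      have finB: "finite B" and cardB: "card B = K ^ (d + 1)"
        by (auto simp: B_def card_PiE intro: finite_PiE)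
      have "\<exists>E. E \<noteq> {} \<and> E \<subseteq> B \<and> (\<forall>N. (\<Sum>e\<in>E. cube_sum d
          (\<lambda>W. (cnj ^^ card W) \<circ> sample K (nat ((vertex e W + r W) mod int K)) (f W))
          (\<lambda>W. (vertex e W + r W) div int K) N) = 0)"
        unfolding B_def K_def by (rule cancel [THEN spec, THEN spec, THEN mp, OF less.prems])
      then obtain E where E: "E \<noteq> {}" "E \<subseteq> B" "(\<Sum>e\<in>E. ?T e) = 0"
        by (elim exE conjE) simp
      have bnd: "norm (?T e) \<le> c * real M powr s" if "e \<in> B" for e
      proof (rule less.IH [OF M], intro allI impI conjI)
        fix W assume W: "W \<subseteq> {1..d}"
        have "nat ((vertex e W + r W) mod int K) < K" using K by (simp add: nat_less_iff)
        then show "sample K (nat ((vertex e W + r W) mod int K)) (f W) \<in> \<K>"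
          using f [OF W] closed_power unfolding K_def by blast
        show "(vertex e W + r W) div int K \<in> {0..int d}"
          using that K r [OF W] W by (intro carry_bound) (auto simp: B_def)
      qed
      have "cube_sum d ?F r (K * M) = (\<Sum>e\<in>B. ?T e)"
        unfolding B_def using K by (subst cube_sum_recursion) (auto simp: sample_def comp_def)
      also have "\<dots> = (\<Sum>e\<in>B - E. ?T e)"
        using sum.subset_diff [OF E(2) finB, of ?T] E(3) by simp
      also have "norm \<dots> \<le> real (card (B - E)) * (c * real M powr s)"
        using bnd by (intro sum_norm_bound) auto
      also have "\<dots> \<le> a * (c * real M powr s)"
      proof (rule mult_right_mono)
        have "card (B - E) < card B"
          using E(1,2) finB by (intro psubset_card_mono) auto
        then have "real (card (B - E)) + 1 \<le> real (K ^ (d + 1))" unfolding cardB by linarith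
        then show "real (card (B - E)) \<le> a" by (simp add: a_def)
      qed (use c in simp)
      finally have main: "norm (cube_sum d ?F r (K * M)) \<le> a * (c * real M powr s)" .
      have "norm (cube_sum d ?F r N - cube_sum d ?F r (K * M)) \<le>
          max C 0 ^ 2 ^ d * (2 ^ d * real (N - K * M) * real N ^ d)"
      proof (rule cube_sum_boundary)
        show "norm (((cnj ^^ card W) \<circ> f W) n) \<le> max C 0" if "W \<subseteq> {1..d}" for W n
          using bound [OF f [OF that], of n] by (simp add: le_max_iff_disj)
      qed (simp add: M_def)
      also have "\<dots> \<le> max C 0 ^ 2 ^ d * (2 ^ d * real K * real N ^ d)"
      proof -
        have "N - K * M = N mod K" by (simp add: M_def minus_mult_div_eq_mod)
        then have "N - K * M \<le> K" using K by (simp add: less_imp_le)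
        then show ?thesis by (intro mult_left_mono mult_right_mono) auto
      qed
      also have "\<dots> = C1 * real N ^ d" by (simp add: C1_def)
      also have "\<dots> \<le> C1 * real N powr s"
      proof (rule mult_left_mono [OF _ C1])
        have "real N ^ d = real N powr real d" using False by (simp add: powr_realpow)
        also have "\<dots> \<le> real N powr s" using False s by (intro powr_mono) auto
        finally show "real N ^ d \<le> real N powr s" .
      qed
      finally have err: "norm (cube_sum d ?F r N - cube_sum d ?F r (K * M)) \<le> C1 * real N powr s" .
      have "real M powr s \<le> (real N / real K) powr s"
      proof (rule powr_mono2)
        have "real (M * K) \<le> real N" unfolding M_def of_nat_le_iff by (rule div_times_less_eq_dividend)
        then show "real M \<le> real N / real K" using K by (simp add: le_divide_eq)
      qed (use s in auto)
      also have "\<dots> = real N powr s / b" by (simp add: powr_divide Ks)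
      finally have "a * (c * real M powr s) \<le> a * (c * (real N powr s / b))"
        using b c by (intro mult_left_mono) auto
      then have "norm (cube_sum d ?F r N) \<le> a * (c * (real N powr s / b)) + C1 * real N powr s"
        using main err norm_triangle_sub [of "cube_sum d ?F r N" "cube_sum d ?F r (K * M)"] by linarith
      also have "\<dots> = (a * c / b + C1) * real N powr s" by (simp add: algebra_simps)
      also have "a * c / b + C1 = c" using b(3) by (simp add: c_def) (simp add: b_def algebra_simps)
      finally show ?thesis .
    qed
  qed
  show ?thesis using s(1) decay by (intro exI [of _ c] exI [of _ s] conjI allI impI)
qed

end

section \<open>Gowers norms\<close>

lemma finprod_integer_mod_group:
  assumes "finite A" "f \<in> A \<rightarrow> carrier (integer_mod_group p)"
  shows "finprod (integer_mod_group p) f A = sum f A mod int p"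
proof -
  interpret comm_group "integer_mod_group p" by simp
  show ?thesis
    using assms
  proof (induction A rule: finite_induct)
    case (insert x A)
    then have "finprod (integer_mod_group p) f (insert x A) =
        f x \<otimes>\<^bsub>integer_mod_group p\<^esub> finprod (integer_mod_group p) f A"
      by (intro finprod_insert) auto
    then show ?case using insert by (simp add: mod_add_right_eq)
  qed simp
qed

text \<open>A vector \<open>\<omega>\<close> is identified with the set \<open>W\<close> of
  coordinates at which it is \<open>1\<close>.\<close>

lemma gowers_average_integer_mod_group:
  assumes p: "0 < p"
  shows "gowers_average (integer_mod_group p) d f =
    (\<Sum>n\<in>{0..d} \<rightarrow>\<^sub>E {0..<int p}. \<Prod>W\<in>Pow {1..d}. (cnj ^^ card W) (f (vertex n W mod int p))) /
    of_nat (p ^ (d + 1))"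
proof -
  let ?Z = "integer_mod_group p"
  have carrier: "carrier ?Z = {0..<int p}" using p by (simp add: carrier_integer_mod_group)
  have "(\<Prod>\<omega>\<in>{1..d} \<rightarrow>\<^sub>E {0, 1::nat}. (cnj ^^ card {i\<in>{1..d}. \<omega> i = 1})
            (f (n 0 \<otimes>\<^bsub>?Z\<^esub> (\<Otimes>\<^bsub>?Z\<^esub>i\<in>{1..d}. n i [^]\<^bsub>?Z\<^esub> \<omega> i)))) =
      (\<Prod>W\<in>Pow {1..d}. (cnj ^^ card W) (f (vertex n W mod int p)))" for n
  proof (rule prod.reindex_bij_witness [of _ "\<lambda>W. \<lambda>i\<in>{1..d}. if i \<in> W then 1 else 0"
        "\<lambda>\<omega>. {i\<in>{1..d}. \<omega> i = 1}"])
    fix \<omega> :: "nat \<Rightarrow> nat" assume \<omega>: "\<omega> \<in> {1..d} \<rightarrow>\<^sub>E {0, 1}"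
    let ?W = "{i \<in> {1..d}. \<omega> i = 1}"
    have \<omega>01: "\<omega> i = 0 \<or> \<omega> i = 1" if "i \<in> {1..d}" for i
      using PiE_mem [OF \<omega> that] by simp
    show "(\<lambda>i\<in>{1..d}. if i \<in> ?W then 1 else 0) = \<omega>"
    proof
      fix i show "(\<lambda>i\<in>{1..d}. if i \<in> ?W then 1 else 0) i = \<omega> i"
        using \<omega>01 [of i] PiE_arb [OF \<omega>, of i] by (cases "i \<in> {1..d}") auto
    qed
    show "?W \<in> Pow {1..d}" by auto
    have "(\<Otimes>\<^bsub>?Z\<^esub>i\<in>{1..d}. n i [^]\<^bsub>?Z\<^esub> \<omega> i) = (\<Sum>i\<in>{1..d}. int (\<omega> i) * n i mod int p) mod int p"
      using p by (subst finprod_integer_mod_group) (auto simp: carrier)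
    also have "\<dots> = (\<Sum>i\<in>{1..d}. int (\<omega> i) * n i) mod int p" by (rule mod_sum_eq)
    also have "(\<Sum>i\<in>{1..d}. int (\<omega> i) * n i) = (\<Sum>i\<in>{1..d}. if \<omega> i = 1 then n i else 0)"
      using \<omega>01 by (intro sum.cong) auto
    also have "\<dots> = (\<Sum>i\<in>?W. n i)" by (rule sum.inter_filter [symmetric]) simp
    finally have "n 0 \<otimes>\<^bsub>?Z\<^esub> (\<Otimes>\<^bsub>?Z\<^esub>i\<in>{1..d}. n i [^]\<^bsub>?Z\<^esub> \<omega> i) = vertex n ?W mod int p"
      by (simp add: vertex_def mod_add_right_eq)
    then show "(cnj ^^ card ?W) (f (vertex n ?W mod int p)) = (cnj ^^ card ?W)
            (f (n 0 \<otimes>\<^bsub>?Z\<^esub> (\<Otimes>\<^bsub>?Z\<^esub>i\<in>{1..d}. n i [^]\<^bsub>?Z\<^esub> \<omega> i)))"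
      by (simp only:)
  next
    fix W assume "W \<in> Pow {1..d}"
    then show "{i \<in> {1..d}. (\<lambda>i\<in>{1..d}. if i \<in> W then 1 else 0 :: nat) i = 1} = W" by auto
    show "(\<lambda>i\<in>{1..d}. if i \<in> W then 1 else 0) \<in> {1..d} \<rightarrow>\<^sub>E {0, 1::nat}" by auto
  qed
  then show ?thesis
    using p by (simp add: gowers_average_def carrier)
qed

lemma funpow_cnj_0 [simp]: "(cnj ^^ m) 0 = 0" and funpow_cnj_1 [simp]: "(cnj ^^ m) 1 = 1"
  by (induction m) simp_all

lemma vertex_mod_cong:
  assumes "finite W" "c 0 mod p = c' 0 mod p" "\<And>i. i \<in> W \<Longrightarrow> c i mod p = c' i mod (p :: int)"
  shows "vertex c W mod p = vertex c' W mod p"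
proof -
  have "(\<Sum>i\<in>W. c i) mod p = (\<Sum>i\<in>W. c' i) mod p"
    using assms(3) by (subst (1 2) mod_sum_eq [symmetric]) simp
  then show ?thesis unfolding vertex_def using assms(2) by (intro mod_add_cong)
qed

text \<open>Since the modulus exceeds \<open>2dN\<close>, a cube of residues with all vertices in \<open>[N]\<close> lifts
  to a cube of integers with the same vertices.\<close>

lemma gowers_average_extend_by_zero:
  assumes p: "2 * d * N < p" and d: "1 \<le> d"
  shows "gowers_average (integer_mod_group p) d (extend_by_zero N f) =
    cube_sum d (\<lambda>W. (cnj ^^ card W) \<circ> f) (\<lambda>_. 0) N / of_nat (p ^ (d + 1))"
proof -
  define T where "T = {n \<in> {0..d} \<rightarrow>\<^sub>E {0..<int p}. \<forall>W\<subseteq>{1..d}. vertex n W mod int p < int N}"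
  \<comment> \<open>The edges are changed by multiples of \<open>p\<close> so that the neighbours of
    the base vertex become the residues themselves, as integers in \<open>[0, p)\<close>.\<close>
  define lift where "lift n = (\<lambda>i\<in>{0..d}. if i = 0 then n 0 else (n 0 + n i) mod int p - n 0)" for n
  define proj where "proj c = (\<lambda>i\<in>{0..d}. c i mod int p)" for c :: "nat \<Rightarrow> int"
  have p0: "0 < p" using p by simp
  have "1 * N \<le> 2 * d * N" using d by (intro mult_right_mono) auto
  from le_less_trans [OF this p] have Np: "N < p" by simp
  have fin: "finite ({0..d} \<rightarrow>\<^sub>E {0..<int p})" by (intro finite_PiE) auto
  have vlift: "vertex (lift n) W mod int p = vertex n W mod int p" if W: "W \<subseteq> {1..d}" for n W
  proof (rule vertex_mod_cong)
    show "finite W" using W finite_subset by blast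
    show "lift n i mod int p = n i mod int p" if "i \<in> W" for i
    proof -
      have "i \<in> {0..d}" "i \<noteq> 0" using that W by auto
      then show ?thesis by (simp add: lift_def mod_diff_left_eq)
    qed
  qed (simp add: lift_def)
  have vproj: "vertex (proj c) W mod int p = vertex c W mod int p" if W: "W \<subseteq> {1..d}" for c W
  proof (rule vertex_mod_cong)
    show "finite W" using W finite_subset by blast
    show "proj c i mod int p = c i mod int p" if "i \<in> W" for i
    proof -
      have "i \<in> {0..d}" using that W by auto
      then show ?thesis by (simp add: proj_def)
    qed
  qed (simp add: proj_def)
  have cube: "0 \<le> vertex c W" "vertex c W < int N" "vertex c W mod int p = vertex c W"
    if "c \<in> int_cubes d (\<lambda>_. 0) N" "W \<subseteq> {1..d}" for c W
  proof -
    show *: "0 \<le> vertex c W" "vertex c W < int N" using that by (simp_all add: int_cubes_def)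
    then show "vertex c W mod int p = vertex c W" using Np by simp
  qed
  have n0: "0 \<le> n 0" "n 0 < int N" "n 0 < int p" and ni: "(n 0 + n i) mod int p < int N"
    if n: "n \<in> T" and i: "i \<in> {1..d}" for n i
  proof -
    have n': "n \<in> {0..d} \<rightarrow>\<^sub>E {0..<int p}" and T: "\<And>W. W \<subseteq> {1..d} \<Longrightarrow> vertex n W mod int p < int N"
      using n by (auto simp: T_def)
    show "0 \<le> n 0" "n 0 < int p" using PiE_mem [OF n', of 0] by auto
    then show "n 0 < int N" using T [of "{}"] by simp
    show "(n 0 + n i) mod int p < int N" using T [of "{i}"] i by (simp add: vertex_def)
  qed
  have lift_eq: "vertex (lift n) W = vertex n W mod int p" if n: "n \<in> T" and W: "W \<subseteq> {1..d}" for n W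
  proof -
    have one: "1 \<in> {1..d}" using d by simp
    have abs: "\<bar>lift n i\<bar> \<le> int N - 1" if "i \<in> {1..d}" for i
    proof -
      have "0 \<le> (n 0 + n i) mod int p" using p0 by simp
      moreover have "lift n i = (n 0 + n i) mod int p - n 0" using that by (simp add: lift_def)
      ultimately show ?thesis
        using n0 [OF n that] ni [OF n that] unfolding abs_le_iff by linarith
    qed
    \<comment> \<open>The lifted vertex and its residue agree modulo \<open>p\<close> and differ by
      less than \<open>(d + 1) * N \<le> 2 * d * N < p\<close>, so they are equal.\<close>
    have "\<bar>\<Sum>i\<in>W. lift n i\<bar> \<le> (\<Sum>i\<in>W. \<bar>lift n i\<bar>)" by (rule sum_abs)
    also have "\<dots> \<le> (\<Sum>i\<in>W. int N - 1)" using abs W by (intro sum_mono) auto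
    also have "\<dots> = int (card W) * (int N - 1)" by simp
    also have "\<dots> \<le> int d * (int N - 1)"
    proof (rule mult_right_mono)
      show "int (card W) \<le> int d" using card_mono [OF _ W] by simp
      show "0 \<le> int N - 1" using n0 [OF n one] by linarith
    qed
    finally have "\<bar>vertex (lift n) W - n 0\<bar> \<le> int d * (int N - 1)"
      by (simp add: vertex_def lift_def)
    moreover have "0 \<le> vertex n W mod int p" "vertex n W mod int p < int N"
      using n W p0 by (auto simp: T_def)
    ultimately have "\<bar>vertex (lift n) W - vertex n W mod int p\<bar> < int d * int N + int N"
      using n0 [OF n one] unfolding right_diff_distrib abs_le_iff abs_less_iff by linarith
    also have "\<dots> = (int d + 1) * int N" by (simp add: distrib_right)
    also have "\<dots> \<le> (2 * int d) * int N" using d by (intro mult_right_mono) auto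
    also have "\<dots> = int (2 * d * N)" by simp
    also have "\<dots> < int p" using p by (simp only: of_nat_less_iff)
    finally have "\<bar>vertex (lift n) W - vertex n W mod int p\<bar> < int p" .
    moreover have "int p dvd vertex (lift n) W - vertex n W mod int p"
      using vlift [OF W, of n] by (metis mod_eq_dvd_iff mod_mod_trivial)
    ultimately show ?thesis using zdvd_not_zless zdvd_imp_le dvd_imp_le_int
      by (metis abs_of_nat eq_iff_diff_eq_0 not_le)
  qed
  have "(\<Sum>n\<in>{0..d} \<rightarrow>\<^sub>E {0..<int p}.
      \<Prod>W\<in>Pow {1..d}. (cnj ^^ card W) (extend_by_zero N f (vertex n W mod int p))) =
    (\<Sum>n\<in>T. \<Prod>W\<in>Pow {1..d}. (cnj ^^ card W) (extend_by_zero N f (vertex n W mod int p)))"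
  proof (rule sum.mono_neutral_right [OF fin])
    show "T \<subseteq> {0..d} \<rightarrow>\<^sub>E {0..<int p}" by (auto simp: T_def)
    show "\<forall>n\<in>({0..d} \<rightarrow>\<^sub>E {0..<int p}) - T.
      (\<Prod>W\<in>Pow {1..d}. (cnj ^^ card W) (extend_by_zero N f (vertex n W mod int p))) = 0"
    proof
      fix n assume "n \<in> ({0..d} \<rightarrow>\<^sub>E {0..<int p}) - T"
      then obtain W where W: "W \<subseteq> {1..d}" "\<not> vertex n W mod int p < int N"
        unfolding T_def by blast
      then have "(cnj ^^ card W) (extend_by_zero N f (vertex n W mod int p)) = 0"
        by (auto simp: extend_by_zero_def)
      then show "(\<Prod>W\<in>Pow {1..d}. (cnj ^^ card W) (extend_by_zero N f (vertex n W mod int p))) = 0"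
        using W(1) by (intro prod_zero) auto
    qed
  qed
  also have "\<dots> = cube_sum d (\<lambda>W. (cnj ^^ card W) \<circ> f) (\<lambda>_. 0) N"
    unfolding cube_sum_def
  proof (rule sum.reindex_bij_witness [of _ proj lift])
    fix n assume n: "n \<in> T"
    then have n': "n \<in> {0..d} \<rightarrow>\<^sub>E {0..<int p}" by (simp add: T_def)
    show "proj (lift n) = n"
    proof
      fix i show "proj (lift n) i = n i"
        using PiE_mem [OF n', of i] PiE_arb [OF n', of i]
        by (cases "i \<in> {0..d}") (auto simp: proj_def lift_def mod_diff_left_eq)
    qed
    have "0 \<le> vertex n W mod int p" "vertex n W mod int p < int N" if "W \<subseteq> {1..d}" for W
      using n that p0 by (auto simp: T_def)
    then show "lift n \<in> int_cubes d (\<lambda>_. 0) N"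
      unfolding int_cubes_def using lift_eq [OF n] by (simp add: lift_def)
    show "(\<Prod>W\<in>Pow {1..d}. ((cnj ^^ card W) \<circ> f) (nat (vertex (lift n) W + 0))) =
        (\<Prod>W\<in>Pow {1..d}. (cnj ^^ card W) (extend_by_zero N f (vertex n W mod int p)))"
    proof (rule prod.cong)
      fix W assume "W \<in> Pow {1..d}"
      then have W: "W \<subseteq> {1..d}" by simp
      have "0 \<le> vertex n W mod int p" "vertex n W mod int p < int N"
        using n W p0 by (auto simp: T_def)
      then have "vertex n W mod int p \<in> int ` {0..<N}"
        by (intro image_eqI [of _ _ "nat (vertex n W mod int p)"]) auto
      then show "((cnj ^^ card W) \<circ> f) (nat (vertex (lift n) W + 0)) =
          (cnj ^^ card W) (extend_by_zero N f (vertex n W mod int p))"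
        by (simp add: lift_eq [OF n W] extend_by_zero_def)
    qed simp
  next
    fix c assume c: "c \<in> int_cubes d (\<lambda>_. 0) N"
    then have c': "c \<in> {0..d} \<rightarrow>\<^sub>E UNIV" by (simp add: int_cubes_def)
    have "vertex (proj c) W mod int p < int N" if "W \<subseteq> {1..d}" for W
      using vproj [OF that] cube [OF c that] by simp
    then show "proj c \<in> T" using p0 by (auto simp: T_def proj_def)
    show "lift (proj c) = c"
    proof
      fix i
      have c0: "c 0 mod int p = c 0" using cube(3) [OF c, of "{}"] by simp
      show "lift (proj c) i = c i"
      proof (cases "i \<in> {1..d}")
        case True
        then have "(c 0 + c i) mod int p = c 0 + c i"
          using cube(3) [OF c, of "{i}"] by (simp add: vertex_def)
        then show ?thesis using True c0 by (simp add: lift_def proj_def mod_add_right_eq)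
      next
        case False
        then show ?thesis using c0 PiE_arb [OF c', of i]
          by (cases "i = 0") (auto simp: lift_def proj_def)
      qed
    qed
  qed
  finally show ?thesis
    using p0 by (simp add: gowers_average_integer_mod_group)
qed

lemma cube_sum_one: "cube_sum d (\<lambda>W. (cnj ^^ card W) \<circ> (\<lambda>_. 1)) r N = of_nat (card (int_cubes d r N))"
  by (simp add: cube_sum_def)

text \<open>Cubes with all coordinates in \<open>[0, q]\<close> have vertices at most
  \<open>(d + 1) * q \<le> N - 1\<close>, and \<open>q + 1 \<ge> N / (d + 1)\<close>.\<close>

lemma card_int_cubes_ge:
  assumes N: "1 \<le> N"
  shows "(real N / real (d + 1)) ^ (d + 1) \<le> real (card (int_cubes d (\<lambda>_. 0) N))"
proof -
  define q where "q = (N - 1) div (d + 1)"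
  have q: "(d + 1) * q \<le> N - 1" "N - 1 < (d + 1) * (q + 1)"
    using times_div_less_eq_dividend [of "d + 1" "N - 1"] dividend_less_times_div [of "d + 1" "N - 1"]
    by (simp_all add: q_def)
  have "{0..d} \<rightarrow>\<^sub>E {0..<int (q + 1)} \<subseteq> int_cubes d (\<lambda>_. 0) N"
  proof
    fix c assume c: "c \<in> {0..d} \<rightarrow>\<^sub>E {0..<int (q + 1)}"
    have ci: "0 \<le> c i" "c i \<le> int q" if "i \<in> {0..d}" for i
      using PiE_mem [OF c that] by auto
    have "0 \<le> vertex c W \<and> vertex c W < int N" if W: "W \<subseteq> {1..d}" for W
    proof -
      have "0 \<le> (\<Sum>i\<in>W. c i)" using ci W by (intro sum_nonneg) auto
      moreover have "(\<Sum>i\<in>W. c i) \<le> (\<Sum>i\<in>W. int q)" using ci W by (intro sum_mono) auto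
      moreover have "(\<Sum>i\<in>W. int q) \<le> int d * int q"
        using card_mono [OF _ W] by (simp add: mult_right_mono)
      moreover have "int ((d + 1) * q) < int N" using q(1) N by linarith
      ultimately show ?thesis using ci [of 0] by (auto simp: vertex_def algebra_simps)
    qed
    then show "c \<in> int_cubes d (\<lambda>_. 0) N" using c by (auto simp: int_cubes_def)
  qed
  then have "card ({0..d} \<rightarrow>\<^sub>E {0..<int (q + 1)}) \<le> card (int_cubes d (\<lambda>_. 0) N)"
    by (intro card_mono finite_int_cubes)
  then have "(q + 1) ^ (d + 1) \<le> card (int_cubes d (\<lambda>_. 0) N)"
    by (simp add: card_PiE nat_add_distrib)
  then have "real (q + 1) ^ (d + 1) \<le> real (card (int_cubes d (\<lambda>_. 0) N))"
    by (metis of_nat_le_iff of_nat_power)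
  moreover have "real N / real (d + 1) \<le> real (q + 1)"
  proof -
    have "N \<le> (q + 1) * (d + 1)" using q(2) by (simp add: algebra_simps)
    then have "real N \<le> real (q + 1) * real (d + 1)" by (simp only: of_nat_le_iff flip: of_nat_mult)
    then show ?thesis by (simp only: divide_le_eq) simp
  qed
  then have "(real N / real (d + 1)) ^ (d + 1) \<le> real (q + 1) ^ (d + 1)"
    by (intro power_mono) auto
  ultimately show ?thesis by linarith
qed

lemma gowers_modulus: "prime (gowers_modulus d N)" "2 * d * N < gowers_modulus d N"
proof -
  have "\<exists>p. prime p \<and> 2 * d * N < p" using bigger_prime [of "2 * d * N"] by blast
  from LeastI_ex [OF this] show "prime (gowers_modulus d N)" "2 * d * N < gowers_modulus d N"
    by (simp_all add: gowers_modulus_def)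
qed

text \<open>The powers of the modulus cancel in the quotient of the two norms, which leaves a root
  of the cube sum divided by the number of cubes.\<close>

lemma gowers_norm_interval_le:
  assumes d: "1 \<le> d" and N: "1 \<le> N"
    and le: "norm (cube_sum d (\<lambda>W. (cnj ^^ card W) \<circ> f) (\<lambda>_. 0) N) \<le> c * real N powr s" and c: "0 \<le> c"
  shows "\<bar>gowers_norm_interval d N f\<bar> \<le>
    root (2 ^ d) (c * real (d + 1) ^ (d + 1)) * real N powr (- ((real (d + 1) - s) / 2 ^ d))"
proof -
  define p where "p = gowers_modulus d N"
  define q where "q = real p ^ (d + 1)"
  define X where "X = cube_sum d (\<lambda>W. (cnj ^^ card W) \<circ> f) (\<lambda>_. 0) N"
  define A where "A = real (card (int_cubes d (\<lambda>_. 0) N))"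
  have p: "2 * d * N < p" unfolding p_def by (rule gowers_modulus)
  have q: "q > 0" using p by (simp add: q_def)
  have "0 < (real N / real (d + 1)) ^ (d + 1)" using N by simp
  with card_int_cubes_ge [OF N, of d] have A: "0 < A" "(real N / real (d + 1)) ^ (d + 1) \<le> A"
    unfolding A_def by linarith+
  have q': "of_nat (p ^ (d + 1)) = complex_of_real q" by (simp add: q_def)
  have "gowers_norm_interval d N f = root (2 ^ d) (Re X / q) / root (2 ^ d) (A / q)"
    unfolding gowers_norm_interval_def gowers_norm_def p_def [symmetric]
      gowers_average_extend_by_zero [OF p d] cube_sum_one X_def [symmetric] q'
    by (simp add: A_def Re_divide_of_real)
  also have "\<dots> = root (2 ^ d) (Re X / A)"
    using q by (simp flip: real_root_divide)
  \<comment> \<open>\<open>root\<close> is an odd function, so the absolute value moves inside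
    whatever the sign of \<open>Re X\<close>.\<close>
  finally have "\<bar>gowers_norm_interval d N f\<bar> = root (2 ^ d) \<bar>Re X / A\<bar>"
    using real_root_abs [of "2 ^ d" "Re X / A"] by simp
  also have "\<dots> \<le> root (2 ^ d) (c * real (d + 1) ^ (d + 1) * real N powr (s - real (d + 1)))"
  proof (rule real_root_le_mono)
    have "\<bar>Re X / A\<bar> = \<bar>Re X\<bar> / A" using A by simp
    also have "\<dots> \<le> (c * real N powr s) / (real N / real (d + 1)) ^ (d + 1)"
      using A N c abs_Re_le_cmod [of X] le unfolding X_def
      by (intro frac_le) auto
    also have "\<dots> = c * real (d + 1) ^ (d + 1) * (real N powr s / real N ^ (d + 1))"
      by (simp only: power_divide divide_divide_eq_right times_divide_eq_right ac_simps)
    also have "real N powr s / real N ^ (d + 1) = real N powr (s - real (d + 1))"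
      using N by (simp only: powr_diff powr_realpow of_nat_0_less_iff)
    finally show "\<bar>Re X / A\<bar> \<le> c * real (d + 1) ^ (d + 1) * real N powr (s - real (d + 1))" .
  qed simp
  also have "\<dots> = root (2 ^ d) (c * real (d + 1) ^ (d + 1)) * root (2 ^ d) (real N powr (s - real (d + 1)))"
    by (rule real_root_mult)
  also have "root (2 ^ d) (real N powr (s - real (d + 1))) = real N powr (- ((real (d + 1) - s) / 2 ^ d))"
  proof -
    have "root (2 ^ d) (real N powr (s - real (d + 1))) = (real N powr (s - real (d + 1))) powr (1 / real (2 ^ d))"
      using N by (intro root_powr_inverse) auto
    also have "\<dots> = real N powr ((s - real (d + 1)) * (1 / real (2 ^ d)))" by (rule powr_powr)
    also have "(s - real (d + 1)) * (1 / real (2 ^ d)) = - ((real (d + 1) - s) / 2 ^ d)"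
      by (simp add: field_simps)
    finally show ?thesis .
  qed
  finally show ?thesis .
qed

theorem theoremA:
  fixes a :: "nat \<Rightarrow> complex"
  assumes "automatic a"
    and "\<And>b :: nat \<Rightarrow> complex. periodic_seq b \<Longrightarrow>
           (\<lambda>N. (1 / of_nat N) * (\<Sum>n = 0..<N. a n * b n)) \<longlonglongrightarrow> 0"
  shows "highly_gowers_uniform a"
proof -
  have "orth_periodic a"
    using assms(2) by (simp add: orth_periodic_def lessThan_atLeast0)
  with assms(1) obtain k z \<K> C where kernel: "kernel_action k z \<K> C" and a: "a \<in> \<K>"
    by (rule kernel_exists)
  have "bounded (range a)"
    using kernel_action.bound [OF kernel a] by (auto simp: bounded_iff)
  moreover have "\<exists>c>0. (\<lambda>N. gowers_norm_interval d N a) \<in> O(\<lambda>N. real N powr (- c))" if d: "1 \<le> d" for d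
  proof -
    \<comment> \<open>One base and one kernel serve every \<open>d\<close>; only \<open>c\<close>
      and \<open>s\<close> depend on \<open>d\<close>.\<close>
    interpret kernel_cube k z \<K> C d
      using kernel d by (simp add: kernel_cube_def kernel_cube_axioms_def)
    obtain c s where s: "s < real (d + 1)" and
      le: "\<forall>f r N. (\<forall>W\<subseteq>{1..d}. f W \<in> \<K> \<and> r W \<in> {0..int d}) \<longrightarrow>
        norm (cube_sum d (\<lambda>W. (cnj ^^ card W) \<circ> f W) r N) \<le> c * real N powr s"
      using cube_sum_decay by (elim exE conjE)
    \<comment> \<open>The sequence itself stands at all vertices, with offsets \<open>0\<close>;
      \<open>max c 0\<close> supplies the nonnegative constant that
      \<open>gowers_norm_interval_le\<close> asks for.\<close>
    have bound: "norm (cube_sum d (\<lambda>W. (cnj ^^ card W) \<circ> a) (\<lambda>_. 0) N) \<le> max c 0 * real N powr s" for N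
    proof -
      have "norm (cube_sum d (\<lambda>W. (cnj ^^ card W) \<circ> a) (\<lambda>_. 0) N) \<le> c * real N powr s"
        by (rule le [THEN spec [of _ "\<lambda>_. a"], THEN spec [of _ "\<lambda>_. 0"], THEN spec, THEN mp]) (simp add: a)
      also have "\<dots> \<le> max c 0 * real N powr s" by (intro mult_right_mono) auto
      finally show ?thesis .
    qed
    have "(\<lambda>N. gowers_norm_interval d N a) \<in> O(\<lambda>N. real N powr (- ((real (d + 1) - s) / 2 ^ d)))"
    proof (rule bigoI)
      show "\<forall>\<^sub>F N in sequentially. norm (gowers_norm_interval d N a) \<le>
          root (2 ^ d) (max c 0 * real (d + 1) ^ (d + 1)) * norm (real N powr (- ((real (d + 1) - s) / 2 ^ d)))"
        using eventually_ge_at_top [of 1]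
      proof eventually_elim
        case (elim N)
        show ?case using gowers_norm_interval_le [OF d elim bound] by simp
      qed
    qed
    moreover have "0 < (real (d + 1) - s) / 2 ^ d" using s by simp
    ultimately show ?thesis by blast
  qed
  ultimately show ?thesis by (simp add: highly_gowers_uniform_def)
qed

end
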